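(* Let $(X,d)$ be a $\delta$-hyperbolic space with base point $o$, and let $G$ be a non-elementary subgroup of the group of isometries of $X$ acting properly discontinuously. Let $\mu$ be a probability measure on $G$ with a finite first moment, whose support generates $G$ as a semigroup, and let $\gamma_0\in G$ be a hyperbolic element. For $k\ge0$ set $$\mu_k=\frac12\mu+\frac14\big(\delta_{\gamma_0^k}+\delta_{\gamma_0^{-k}}\big).$$ Then $$\lim_{k\to\infty}\frac{h(G,\mu_k)}{l(G,\mu_k)}=0.$$
   Context: $\delta$-hyperbolic space: a proper geodesic metric space $(X,d)$ such that, with $(x|y)_o=\frac12[d(o,x)+d(o,y)-d(x,y)]$, one has $(x|z)_o\ge\min\{(x|y)_o,(y|z)_o\}-\delta$ for all $x,y,z,o\in X$. The hyperbolic boundary $\partial X$ is the set of geodesic rays modulo equivalence (two rays are equivalent if they stay at bounded distance), and $X\cup\partial X$ carries its usual compact topology. Properly discontinuous: for every compact $K\subset X$ the set $\{g\in G: gK\cap K\neq\emptyset\}$ is finite. The limit set $\Lambda_G$ is the set of accumulation points in $\partial X$ of an orbit $Gx$, $x\in X$ (independent of $x$); $G$ is non-elementary if $\Lambda_G$ has more than two elements. An isometry $g$ is hyperbolic if there are constants $\lambda,c$ with $\lambda^{-1}|n-m|-c\le d(g^no,g^mo)\le\lambda|n-m|+c$ for all $n,m\in\mathbb Z$. Finite first moment: $\sum_{g\in G}\mu(g)d(o,go)<\infty$. Entropy: $H(\lambda)=-\sum_g\lambda(g)\log\lambda(g)$ for a probability measure $\lambda$ on $G$. For a probability measure $\mu$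 on $G$ with finite first moment and $n$-th convolution power $\mu^n$, the rate of escape is $l(G,\mu)=\lim_n\frac1n\sum_g\mu^n(g)d(o,go)$ and the asymptotic entropy is $h(G,\mu)=\lim_n\frac1nH(\mu^n)$. $\delta_g$ denotes the Dirac mass at $g\in G$.
   Formalization: Entropy is taken real-valued, a divergent series for H counting as 0; finite first moment does not force H(μ) to be finite, and where H(μ) is infinite, h(G,μ_k) is infinite and the claim as written fails, so it has content only for finite H(μ). *)

theory Defs
  imports "HOL-Probability.Probability" "HOL-Algebra.Group"
begin

text \<open>
  The space \<open>X\<close> is the whole of a type of class \<^class>\<open>metric_space\<close>, and an isometry is a
  function on that type.  The base point is written \<open>p\<close>, since \<open>o\<close> is composition.
\<close>

section \<open>Hyperbolic spaces\<close>

definition gromov_product :: "'a::metric_space \<Rightarrow> 'a \<Rightarrow> 'a \<Rightarrow> real"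
  where "gromov_product p x y = (dist p x + dist p y - dist x y) / 2"

definition proper_space :: "'a::metric_space itself \<Rightarrow> bool"
  where "proper_space _ \<longleftrightarrow> (\<forall>(x::'a) r. compact (cball x r))"

definition geodesic_space :: "'a::metric_space itself \<Rightarrow> bool"
  where "geodesic_space _ \<longleftrightarrow>
    (\<forall>(x::'a) y. \<exists>\<gamma>::real \<Rightarrow> 'a. \<gamma> 0 = x \<and> \<gamma> (dist x y) = y \<and>
      (\<forall>s\<in>{0..dist x y}. \<forall>t\<in>{0..dist x y}. dist (\<gamma> s) (\<gamma> t) = \<bar>s - t\<bar>))"

definition hyperbolic_space :: "real \<Rightarrow> 'a::metric_space itself \<Rightarrow> bool"
  where "hyperbolic_space \<delta> X \<longleftrightarrow> proper_space X \<and> geodesic_space X \<and>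
    (\<forall>(x::'a) y z p.
      gromov_product p x z \<ge> min (gromov_product p x y) (gromov_product p y z) - \<delta>)"

section \<open>The boundary and the compactification\<close>

definition geodesic_ray :: "(real \<Rightarrow> 'a::metric_space) \<Rightarrow> bool"
  where "geodesic_ray \<gamma> \<longleftrightarrow> (\<forall>s\<ge>0. \<forall>t\<ge>0. dist (\<gamma> s) (\<gamma> t) = \<bar>s - t\<bar>)"

definition asymptotic :: "((real \<Rightarrow> 'a::metric_space) \<times> (real \<Rightarrow> 'a)) set"
  where "asymptotic = {(\<gamma>, \<gamma>'). geodesic_ray \<gamma> \<and> geodesic_ray \<gamma>' \<and>
    (\<exists>C. \<forall>t\<ge>0. dist (\<gamma> t) (\<gamma>' t) \<le> C)}"

text \<open>
  Rays are total functions whose values at negative arguments are irrelevant; these values are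
  forgotten in the quotient.
\<close>

definition boundary :: "(real \<Rightarrow> 'a::metric_space) set set"
  where "boundary = Collect geodesic_ray // asymptotic"

text \<open>
  The neighbourhood of radius parameter \<open>r\<close> of a boundary point \<open>\<xi>\<close> in \<open>X \<union> \<partial>X\<close> consists of the
  points whose Gromov product with \<open>\<xi>\<close> is at least \<open>r\<close>, where the Gromov product is extended to
  the boundary as a lower limit along rays.  In a hyperbolic space another choice of the rays in
  their classes changes the lower limit by a bounded amount only.
\<close>

definition boundary_nhd ::
    "'a::metric_space \<Rightarrow> (real \<Rightarrow> 'a) set \<Rightarrow> real \<Rightarrow> ('a + (real \<Rightarrow> 'a) set) set"
  where "boundary_nhd p \<xi> r =
    Inl ` {y. \<exists>\<gamma>\<in>\<xi>. ereal r \<le> Liminf at_top (\<lambda>t. ereal (gromov_product p (\<gamma> t) y))} \<union>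
    Inr ` {\<eta>\<in>boundary. \<exists>\<gamma>\<in>\<xi>. \<exists>\<gamma>'\<in>\<eta>.
      ereal r \<le> Liminf at_top (\<lambda>t. ereal (gromov_product p (\<gamma> t) (\<gamma>' t)))}"

definition bordification_open ::
    "'a::metric_space \<Rightarrow> ('a + (real \<Rightarrow> 'a) set) set \<Rightarrow> bool"
  where "bordification_open p U \<longleftrightarrow>
    U \<subseteq> range Inl \<union> Inr ` boundary \<and> open (Inl -` U) \<and>
    (\<forall>\<xi>. Inr \<xi> \<in> U \<longrightarrow> (\<exists>r. boundary_nhd p \<xi> r \<subseteq> U))"

definition bordification :: "'a::metric_space \<Rightarrow> ('a + (real \<Rightarrow> 'a) set) topology"
  where "bordification p = topology (bordification_open p)"

lemma boundary_nhd_antimono: "r \<le> s \<Longrightarrow> boundary_nhd p \<xi> s \<subseteq> boundary_nhd p \<xi> r"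
proof -
  assume "r \<le> s"
  then have *: "ereal s \<le> L \<Longrightarrow> ereal r \<le> L" for L
    by (rule order_trans[OF ereal_less_eq(3)[THEN iffD2]])
  show ?thesis
    unfolding boundary_nhd_def
    apply (rule Un_mono)
     apply (rule image_mono, rule Collect_mono, rule impI)
     apply (erule bexE, rule bexI, erule *, assumption)
    apply (rule image_mono, rule Collect_mono, rule impI)
    apply (erule conjE, rule conjI, assumption)
    apply (erule bexE, erule bexE, rule bexI, rule bexI, erule *, assumption, assumption)
    done
qed

lemma istopology_bordification_open: "istopology (bordification_open p)"
  unfolding istopology_def
proof (intro conjI allI impI)
  fix S T
  assume S: "bordification_open p S" and T: "bordification_open p T"
  show "bordification_open p (S \<inter> T)"
    unfolding bordification_open_def
  proof (intro conjI allI impI)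
    show "S \<inter> T \<subseteq> range Inl \<union> Inr ` boundary"
      using S unfolding bordification_open_def by (rule conjE) (rule le_infI1)
    have "open (Inl -` S)" "open (Inl -` T)"
      using S T by (simp_all only: bordification_open_def)
    then show "open (Inl -` (S \<inter> T))"
      by (simp only: vimage_Int open_Int)
  next
    fix \<xi>
    assume "Inr \<xi> \<in> S \<inter> T"
    then have "Inr \<xi> \<in> S" "Inr \<xi> \<in> T"
      by (rule IntD1, rule IntD2)
    then obtain r s where "boundary_nhd p \<xi> r \<subseteq> S" "boundary_nhd p \<xi> s \<subseteq> T"
      using S T unfolding bordification_open_def by (elim conjE) metis
    moreover have "boundary_nhd p \<xi> (max r s) \<subseteq> boundary_nhd p \<xi> r"
      "boundary_nhd p \<xi> (max r s) \<subseteq> boundary_nhd p \<xi> s"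
      by (simp_all add: boundary_nhd_antimono)
    ultimately have "boundary_nhd p \<xi> (max r s) \<subseteq> S \<inter> T"
      by (meson Int_greatest subset_trans)
    then show "\<exists>r. boundary_nhd p \<xi> r \<subseteq> S \<inter> T" ..
  qed
next
  fix \<K>
  assume "\<forall>K\<in>\<K>. bordification_open p K"
  then have K: "K \<subseteq> range Inl \<union> Inr ` boundary" "open (Inl -` K)"
    "\<And>\<xi>. Inr \<xi> \<in> K \<Longrightarrow> \<exists>r. boundary_nhd p \<xi> r \<subseteq> K" if "K \<in> \<K>" for K
    using that by (simp_all only: bordification_open_def Ball_def)
  show "bordification_open p (\<Union>\<K>)"
    unfolding bordification_open_def
  proof (intro conjI allI impI)
    show "\<Union>\<K> \<subseteq> range Inl \<union> Inr ` boundary"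
      by (intro Union_least K(1))
    show "open (Inl -` \<Union>\<K>)"
      unfolding vimage_Union by (intro open_UN ballI K(2))
  next
    fix \<xi>
    assume "Inr \<xi> \<in> \<Union>\<K>"
    then obtain K where KK: "K \<in> \<K>" "Inr \<xi> \<in> K"
      by (rule UnionE)
    from K(3)[OF this] obtain r where "boundary_nhd p \<xi> r \<subseteq> K" ..
    also have "K \<subseteq> \<Union>\<K>"
      using KK(1) by (rule Union_upper)
    finally show "\<exists>r. boundary_nhd p \<xi> r \<subseteq> \<Union>\<K>" ..
  qed
qed

lemma openin_bordification: "openin (bordification p) U \<longleftrightarrow> bordification_open p U"
  by (simp add: bordification_def topology_inverse'[OF istopology_bordification_open])

lemma topspace_bordification:
  fixes p :: "'a::metric_space"
  shows "topspace (bordification p) = range Inl \<union> Inr ` boundary"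
proof (rule subset_antisym)
  have "U \<subseteq> range Inl \<union> Inr ` boundary" if "openin (bordification p) U" for U
    using that by (simp only: openin_bordification bordification_open_def)
  then show "topspace (bordification p) \<subseteq> range Inl \<union> Inr ` boundary"
    using openin_topspace by metis
  have "Inl -` (range Inl \<union> Inr ` (boundary :: (real \<Rightarrow> 'a) set set)) = (UNIV :: 'a set)"
    by auto
  moreover have "boundary_nhd p \<xi> r \<subseteq> range Inl \<union> Inr ` boundary" for \<xi> r
    unfolding boundary_nhd_def by (intro Un_mono image_mono) auto
  ultimately have "bordification_open p (range Inl \<union> Inr ` boundary)"
    by (simp only: bordification_open_def open_UNIV) simp
  then show "range Inl \<union> Inr ` boundary \<subseteq> topspace (bordification p)"
    by (intro openin_subset) (simp only: openin_bordification)
qed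

section \<open>Groups of isometries\<close>

definition isometry_group :: "('a::metric_space \<Rightarrow> 'a) monoid"
  where "isometry_group =
    \<lparr>carrier = {g. surj g \<and> (\<forall>x y. dist (g x) (g y) = dist x y)}, mult = (\<circ>), one = id\<rparr>"

lemma group_isometry_group: "group (isometry_group :: ('a::metric_space \<Rightarrow> 'a) monoid)"
proof (rule groupI)
  fix g :: "'a \<Rightarrow> 'a"
  assume "g \<in> carrier isometry_group"
  then have g: "surj g" "\<And>x y. dist (g x) (g y) = dist x y"
    by (auto simp: isometry_group_def)
  have "inj g"
    by (metis g(2) injI dist_eq_0_iff)
  moreover have "dist (inv_into UNIV g x) (inv_into UNIV g y) = dist x y" for x y
    by (metis g surj_f_inv_f)
  ultimately have "inv_into UNIV g \<in> carrier isometry_group \<and> inv_into UNIV g \<circ> g = id"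
    by (simp add: isometry_group_def inj_imp_surj_inv)
  then show "\<exists>h\<in>carrier isometry_group. h \<otimes>\<^bsub>isometry_group\<^esub> g = \<one>\<^bsub>isometry_group\<^esub>"
    by (auto simp: isometry_group_def)
qed (simp_all add: isometry_group_def o_assoc surj_def, metis)

definition properly_discontinuous :: "('a::metric_space \<Rightarrow> 'a) set \<Rightarrow> bool"
  where "properly_discontinuous G \<longleftrightarrow> (\<forall>K. compact K \<longrightarrow> finite {g\<in>G. g ` K \<inter> K \<noteq> {}})"

definition limit_set :: "'a::metric_space \<Rightarrow> ('a \<Rightarrow> 'a) set \<Rightarrow> (real \<Rightarrow> 'a) set set"
  where "limit_set p G =
    {\<xi>\<in>boundary. Inr \<xi> \<in> bordification p derived_set_of (Inl ` (\<lambda>g. g p) ` G)}"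

definition non_elementary :: "'a::metric_space \<Rightarrow> ('a \<Rightarrow> 'a) set \<Rightarrow> bool"
  where "non_elementary p G \<longleftrightarrow> infinite (limit_set p G) \<or> card (limit_set p G) > 2"

definition hyperbolic_isometry :: "'a::metric_space \<Rightarrow> ('a \<Rightarrow> 'a) \<Rightarrow> bool"
  where "hyperbolic_isometry p g \<longleftrightarrow> g \<in> carrier isometry_group \<and>
    (\<exists>\<Lambda>>0. \<exists>c. \<forall>n m :: int.
      let D = dist ((g [^]\<^bsub>isometry_group\<^esub> n) p) ((g [^]\<^bsub>isometry_group\<^esub> m) p)
      in inverse \<Lambda> * \<bar>real_of_int (n - m)\<bar> - c \<le> D \<and> D \<le> \<Lambda> * \<bar>real_of_int (n - m)\<bar> + c)"

definition semigroup_generated :: "('a \<Rightarrow> 'a) set \<Rightarrow> ('a \<Rightarrow> 'a) set"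
  where "semigroup_generated A = (\<lambda>S. \<forall>g\<in>S. \<forall>h\<in>S. g \<circ> h \<in> S) hull A"

section \<open>Random walks\<close>

text \<open>
  A group acting properly discontinuously on a proper space is countable, so that the probability
  measures on \<open>G\<close> are exactly the \<open>pmf\<close>s with support in \<open>G\<close>.
\<close>

definition finite_first_moment ::
    "'a::metric_space \<Rightarrow> ('a \<Rightarrow> 'a) set \<Rightarrow> ('a \<Rightarrow> 'a) pmf \<Rightarrow> bool"
  where "finite_first_moment p G \<mu> \<longleftrightarrow> (\<lambda>g. pmf \<mu> g * dist p (g p)) summable_on G"

primrec convolution_power :: "('a \<Rightarrow> 'a) pmf \<Rightarrow> nat \<Rightarrow> ('a \<Rightarrow> 'a) pmf"
  where
    "convolution_power \<mu> 0 = return_pmf id"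
  | "convolution_power \<mu> (Suc n) =
      map_pmf (\<lambda>(g, h). g \<circ> h) (pair_pmf (convolution_power \<mu> n) \<mu>)"

text \<open>
  Entropy is real valued, as is required for the asymptotic entropy to be a number: if the series
  diverges, \<open>infsum\<close> makes it 0.  A finite first moment alone does not exclude this when the
  orbits of \<open>G\<close> grow faster than exponentially.
\<close>

definition shannon_entropy :: "('a \<Rightarrow> 'a) set \<Rightarrow> ('a \<Rightarrow> 'a) pmf \<Rightarrow> real"
  where "shannon_entropy G \<mu> = - (\<Sum>\<^sub>\<infinity>g\<in>G. pmf \<mu> g * ln (pmf \<mu> g))"

definition asymptotic_entropy :: "('a \<Rightarrow> 'a) set \<Rightarrow> ('a \<Rightarrow> 'a) pmf \<Rightarrow> real"
  where "asymptotic_entropy G \<mu> = lim (\<lambda>n. 1 / real n * shannon_entropy G (convolution_power \<mu> n))"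

definition rate_of_escape :: "'a::metric_space \<Rightarrow> ('a \<Rightarrow> 'a) set \<Rightarrow> ('a \<Rightarrow> 'a) pmf \<Rightarrow> real"
  where "rate_of_escape p G \<mu> =
    lim (\<lambda>n. 1 / real n * (\<Sum>\<^sub>\<infinity>g\<in>G. pmf (convolution_power \<mu> n) g * dist p (g p)))"

definition mixed_measure ::
    "('a::metric_space \<Rightarrow> 'a) pmf \<Rightarrow> ('a \<Rightarrow> 'a) \<Rightarrow> nat \<Rightarrow> ('a \<Rightarrow> 'a) pmf"
  where "mixed_measure \<mu> \<gamma> k = embed_pmf (\<lambda>g. 1/2 * pmf \<mu> g +
    1/4 * (pmf (return_pmf (\<gamma> [^]\<^bsub>isometry_group\<^esub> int k)) g +
           pmf (return_pmf (\<gamma> [^]\<^bsub>isometry_group\<^esub> (- int k))) g))"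

lemma pmf_mixed_measure:
  "pmf (mixed_measure \<mu> \<gamma> k) g = 1/2 * pmf \<mu> g +
    1/4 * (pmf (return_pmf (\<gamma> [^]\<^bsub>isometry_group\<^esub> int k)) g +
           pmf (return_pmf (\<gamma> [^]\<^bsub>isometry_group\<^esub> (- int k))) g)"
  unfolding mixed_measure_def
proof (rule pmf_embed_pmf)
  define \<nu> where "\<nu> j = return_pmf (\<gamma> [^]\<^bsub>isometry_group\<^esub> (j::int))" for j
  have one: "(\<integral>\<^sup>+ x. ennreal (pmf q x) \<partial>count_space UNIV) = 1" for q :: "('a \<Rightarrow> 'a) pmf"
    by (simp add: nn_integral_pmf measure_pmf.emeasure_space_1)
  have "(\<integral>\<^sup>+ x. ennreal (1/2 * pmf \<mu> x + 1/4 * (pmf (\<nu> (int k)) x + pmf (\<nu> (- int k)) x))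
           \<partial>count_space UNIV)
      = (\<integral>\<^sup>+ x. ennreal (1/2) * ennreal (pmf \<mu> x) + ennreal (1/4) *
           (ennreal (pmf (\<nu> (int k)) x) + ennreal (pmf (\<nu> (- int k)) x)) \<partial>count_space UNIV)"
    by (intro nn_integral_cong) (simp only: ennreal_plus ennreal_mult' pmf_nonneg add_nonneg_nonneg
        mult_nonneg_nonneg zero_le_divide_1_iff zero_le_numeral)
  also have "\<dots> = ennreal (1/2) * 1 + ennreal (1/4) * (1 + 1)"
    by (simp only: nn_integral_add nn_integral_cmult one borel_measurable_count_space)
  also have "\<dots> = ennreal (1/2) + ennreal (1/4) * ennreal 2"
    by simp
  also have "\<dots> = ennreal (1/2 + 1/4 * 2)"
    by (subst ennreal_mult'[symmetric], simp, subst ennreal_plus[symmetric], simp_all)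
  finally show "(\<integral>\<^sup>+ x. ennreal (1/2 * pmf \<mu> x +
      1/4 * (pmf (return_pmf (\<gamma> [^]\<^bsub>isometry_group\<^esub> int k)) x +
             pmf (return_pmf (\<gamma> [^]\<^bsub>isometry_group\<^esub> (- int k))) x)) \<partial>count_space UNIV) = 1"
    by (simp add: \<nu>_def)
qed (simp add: pmf_nonneg)

end

theory Submission
  imports Defs
begin

text \<open>
  Write \<open>T k\<close> for the powers of \<open>\<gamma>\<^sub>0\<close> and \<open>\<mu>\<^sub>k\<close> for the mixtures.  The entropies of the \<open>\<mu>\<^sub>k\<close> are bounded
  in \<open>k\<close>, infinite ones being counted as 0, since the mixture adds only the entropy of choosing a part
  (\<open>shannon_entropy_mixed_measure_le\<close>); by subadditivity so are the asymptotic entropies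
  (\<open>asymptotic_entropy_bounds\<close>).  It remains to see that the rate of escape tends to infinity.

  Let \<open>x\<close> be the position of the walk, new steps acting from the left.  A step from
  \<open>\<mu>\<close> brings \<open>x\<close> closer to the base point \<open>p\<close> by at most the first moment on average.  The two steps
  \<open>T k\<close> and \<open>T (- k)\<close> together lose at most a constant, because \<open>x\<close> cannot point towards both ends of the
  axis (\<open>translation_no_loss\<close>), and if \<open>x\<close> points towards neither end they move it away by the
  displacement \<open>dist p (T k p)\<close> each, up to a constant (\<open>translation_gain\<close>).  This displacement grows
  linearly in \<open>k\<close>.  So the walk escapes fast unless it spends nearly all its time near the ends of
  the axis.

  That is prevented by an element \<open>h\<close> of \<open>G\<close> that maps both ends of the axis away from
  both ends: for every \<open>x\<close>, either \<open>x\<close> or \<open>h x\<close> points towards neither end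
  (\<open>away_from_ends_or_moved_away\<close>).  As \<open>h\<close> is a product of \<open>m\<close> elements of the support of \<open>\<mu>\<close>, the walk
  performs it in \<open>m\<close> steps with probability at least some \<open>q\<close> independent of \<open>k\<close> (\<open>reached_uniformly\<close>).  Each block
  of \<open>m + 1\<close> steps thus gains about \<open>q / 2\<close> times the displacement of \<open>T k\<close>, minus a constant
  (\<open>rate_of_escape_ge\<close>).

  For the existence of \<open>h\<close>, suppose that \<open>g \<in> G\<close> maps an end of the axis to an end.  Discreteness forces
  \<open>g\<close> to conjugate some power of \<open>\<gamma>\<^sub>0\<close> to itself or to its inverse, so that \<open>g p\<close> lies within a distance of
  the axis that does not depend on \<open>g\<close> (\<open>near_axis_if_common_end\<close>).  If this held for all \<open>g\<close>, every limit
  point would be one of the two ends of the axis, and \<open>G\<close> would be elementary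
  (\<open>elementary_if_orbit_near_axis\<close>).
\<close>

section \<open>Gromov products\<close>

lemma gromov_product_commute: "gromov_product p x y = gromov_product p y x"
  by (simp add: gromov_product_def dist_commute)

lemma gromov_product_le_dist: "gromov_product p x y \<le> dist p x"
  using dist_triangle[of p y x] by (simp add: gromov_product_def field_simps)

lemma gromov_product_le_dist': "gromov_product p x y \<le> dist p y"
  using gromov_product_le_dist gromov_product_commute by metis

lemma gromov_product_change:
  "gromov_product p x y \<le> gromov_product p x y' + dist y y'"
  using dist_triangle[of p y y'] dist_triangle[of x y' y]
  by (simp add: gromov_product_def field_simps dist_commute)

lemma gromov_product_change_base:
  "gromov_product q x y \<le> gromov_product p x y + dist p q"
  using dist_triangle[of q x p] dist_triangle[of q y p]
  by (simp add: gromov_product_def field_simps dist_commute)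

lemma gromov_product_isometry:
  assumes "\<And>x y. dist (g x) (g y) = dist x y"
  shows "gromov_product (g p) (g x) (g y) = gromov_product p x y"
  by (simp add: gromov_product_def assms)

definition gromov_hyperbolic :: "real \<Rightarrow> 'a::metric_space itself \<Rightarrow> bool"
  where "gromov_hyperbolic \<delta> _ \<longleftrightarrow>
    (\<forall>(x::'a) y z p.
      gromov_product p x z \<ge> min (gromov_product p x y) (gromov_product p y z) - \<delta>)"

lemma hyperbolic_space_gromov_hyperbolic:
  "hyperbolic_space \<delta> X \<Longrightarrow> gromov_hyperbolic \<delta> X"
  by (simp add: hyperbolic_space_def gromov_hyperbolic_def)

lemma gromov_hyperbolicD:
  fixes x y z p :: "'a::metric_space"
  assumes "gromov_hyperbolic \<delta> TYPE('a)"
  shows "min (gromov_product p x y) (gromov_product p y z) \<le> gromov_product p x z + \<delta>"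
proof -
  have "min (gromov_product p x y) (gromov_product p y z) - \<delta> \<le> gromov_product p x z"
    using assms unfolding gromov_hyperbolic_def by blast
  then show ?thesis by linarith
qed

lemma gromov_hyperbolic_nonneg:
  assumes "gromov_hyperbolic \<delta> TYPE('a::metric_space)"
  shows "0 \<le> \<delta>"
  using gromov_hyperbolicD[OF assms, of undefined undefined undefined undefined]
  by (simp add: gromov_product_def)

text \<open>
  The inequality for Gromov products in the form that is symmetric in the four points: of the three
  sums of opposite distances, the two largest differ by at most \<open>2 \<delta>\<close>.
\<close>

lemma four_point:
  fixes x y z w :: "'a::metric_space"
  assumes "gromov_hyperbolic \<delta> TYPE('a)"
  shows "dist x z + dist y w \<le> max (dist x y + dist z w) (dist x w + dist y z) + 2 * \<delta>"
  using gromov_hyperbolicD[OF assms, of w x y z]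
  by (auto simp: gromov_product_def dist_commute max_def min_def field_simps split: if_splits)

text \<open>
  Geodesic rays and orbits of hyperbolic isometries are both covered by the following criterion:
  \<open>f s\<close> is the distance that the path has travelled from the base point up to parameter \<open>s\<close>,
  and up to bounded error no distance is lost later.
\<close>

lemma fellow_travel:
  fixes u v :: "'i::linorder \<Rightarrow> 'a::metric_space"
  assumes hyp: "gromov_hyperbolic \<delta> TYPE('a)"
    and u: "\<And>s t. s0 \<le> s \<Longrightarrow> s \<le> t \<Longrightarrow> f s - C \<le> gromov_product p (u s) (u t)"
    and v: "\<And>s t. s0 \<le> s \<Longrightarrow> s \<le> t \<Longrightarrow> f s - C \<le> gromov_product p (v s) (v t)"
    and le: "dist p (u s) \<le> f s + C" "dist p (v s) \<le> f s + C"
    and far: "\<And>M. \<exists>i\<ge>s. \<exists>j\<ge>s. M \<le> gromov_product p (u i) (v j)"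
    and s: "s0 \<le> s"
  shows "dist (u s) (v s) \<le> 4 * C + 4 * \<delta>"
proof -
  obtain i j where ij: "i \<ge> s" "j \<ge> s" "f s - C \<le> gromov_product p (u i) (v j)"
    using far by blast
  have "f s - C - \<delta> \<le> gromov_product p (u s) (v j)"
    using gromov_hyperbolicD[OF hyp, of p "u s" "u i" "v j"] u[OF s ij(1)] ij(3) by linarith
  moreover have "f s - C \<le> gromov_product p (v j) (v s)"
    using v[OF s ij(2)] by (simp add: gromov_product_commute)
  moreover have "0 \<le> \<delta>"
    by (rule gromov_hyperbolic_nonneg[OF hyp])
  ultimately have "f s - C - 2 * \<delta> \<le> gromov_product p (u s) (v s)"
    using gromov_hyperbolicD[OF hyp, of p "u s" "v j" "v s"] by linarith
  then show ?thesis
    using le by (simp add: gromov_product_def field_simps)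
qed

section \<open>The axis of a hyperbolic isometry\<close>

text \<open>
  The powers of a hyperbolic isometry, as a group of isometries indexed by the integers.  The
  condition \<open>ends_apart\<close> is the form in which the quasi-geodesic property enters: displacements
  of the base point are additive up to \<open>2 C\<close>, so that an orbit point lies almost between any two
  orbit points on either side of it.
\<close>

locale loxodromic =
  fixes p :: "'a::metric_space" and \<delta> C :: real and T :: "int \<Rightarrow> 'a \<Rightarrow> 'a"
  assumes hyp: "gromov_hyperbolic \<delta> TYPE('a)"
    and T_0: "T 0 x = x"
    and T_add: "T (i + j) x = T i (T j x)"
    and T_dist: "dist (T i x) (T i y) = dist x y"
    and ends_apart: "0 \<le> m \<Longrightarrow> 0 \<le> n \<Longrightarrow> gromov_product p (T (- m) p) (T n p) \<le> C"
    and escapes: "\<exists>N. \<forall>n. N \<le> \<bar>n\<bar> \<longrightarrow> M \<le> dist p (T n p)"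
begin

lemma delta_nonneg: "0 \<le> \<delta>"
  by (rule gromov_hyperbolic_nonneg[OF hyp])

lemma reversed: "loxodromic p \<delta> C (\<lambda>i. T (- i))"
proof
  fix i j m n :: int and x y and M
  show "T (- (i + j)) x = T (- i) (T (- j) x)"
    using T_add[of "- i" "- j"] by simp
  show "\<exists>N. \<forall>n. N \<le> \<bar>n\<bar> \<longrightarrow> M \<le> dist p (T (- n) p)"
    using escapes[of M] by (metis abs_minus_cancel)
  assume "0 \<le> m" "0 \<le> n"
  then show "gromov_product p (T (- (- m)) p) (T (- n) p) \<le> C"
    using ends_apart[of n m] by (simp add: gromov_product_commute)
qed (simp_all add: hyp T_0 T_dist)

lemma T_cancel [simp]: "T (- i) (T i x) = x" "T i (T (- i) x) = x"
  using T_add[of "- i" i x] T_add[of i "- i" x] by (simp_all add: T_0)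

lemma dist_orbit: "dist (T i p) (T j p) = dist p (T (j - i) p)"
  using T_dist[of i p "T (j - i) p"] T_add[of i "j - i" p] by simp

lemma dist_minus: "dist p (T (- i) p) = dist p (T i p)"
  using dist_orbit[of i 0] by (simp add: T_0 dist_commute)

lemma gromov_product_T: "gromov_product (T i q) (T i x) (T i y) = gromov_product q x y"
  by (rule gromov_product_isometry) (rule T_dist)

lemma between:
  assumes "i \<le> j" "j \<le> k"
  shows "gromov_product (T j p) (T i p) (T k p) \<le> C"
proof -
  have "gromov_product (T j p) (T i p) (T k p)
      = gromov_product (T j p) (T j (T (- (j - i)) p)) (T j (T (k - j) p))"
    using T_add[of j "- (j - i)" p] T_add[of j "k - j" p] by simp
  also have "\<dots> \<le> C"
    unfolding gromov_product_T using assms by (intro ends_apart) auto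
  finally show ?thesis .
qed

lemma C_nonneg: "0 \<le> C"
  using ends_apart[of 0 0] by (simp add: T_0 gromov_product_def)

lemma same_side:
  assumes "0 \<le> m" "m \<le> n"
  shows "dist p (T m p) - C \<le> gromov_product p (T m p) (T n p)"
  using between[of 0 m n] assms
  by (simp add: gromov_product_def T_0 dist_commute field_simps)

text \<open>
  The product with one end of the axis changes from large to bounded along the axis, while by
  hyperbolicity the products with both ends cannot be large at once; where they swap, the axis
  passes close to \<open>q\<close>.
\<close>

lemma near_axis:
  assumes K: "gromov_product q (T (- n) p) (T n p) \<le> K"
    and far: "K + \<delta> < dist q (T (- n) p)" "K + \<delta> < dist q (T n p)" and n: "0 \<le> n"
  shows "\<exists>j. dist q (T j p) \<le> 2 * K + 2 * \<delta> + dist p (T 1 p) + C"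
proof -
  define a where "a j = gromov_product q (T (- n) p) (T j p)" for j
  define b where "b j = gromov_product q (T j p) (T n p)" for j
  have ab: "a j \<le> K + \<delta> \<or> b j \<le> K + \<delta>" for j
    using gromov_hyperbolicD[OF hyp, of q "T (- n) p" "T j p" "T n p"] K
    by (auto simp: a_def b_def min_def split: if_splits)
  have "K + \<delta> < a (- n)" "K + \<delta> < b n"
    using far by (simp_all add: a_def b_def gromov_product_def)
  then have b0: "b (- n) \<le> K + \<delta>"
    using ab by force
  \<comment> \<open>The last parameter at which the product with the forward end is still bounded.\<close>
  define J where "J = {j. - n \<le> j \<and> j \<le> n \<and> b j \<le> K + \<delta>}"
  have J: "finite J" "- n \<in> J"
    using b0 n by (auto simp: J_def intro: finite_subset[of _ "{- n..n}"])
  define j where "j = Max J"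
  have "j \<in> J"
    unfolding j_def using J by (intro Max_in) auto
  then have j: "- n \<le> j" "j < n" "b j \<le> K + \<delta>"
    using \<open>K + \<delta> < b n\<close> by (auto simp: J_def less_le)
  have "j + 1 \<notin> J"
    using Max_ge[OF J(1), of "j + 1"] by (auto simp: j_def)
  then have "a (j + 1) \<le> K + \<delta>"
    using j ab[of "j + 1"] by (auto simp: J_def)
  moreover have "a j \<le> a (j + 1) + dist p (T 1 p)"
    using gromov_product_change[of q "T (- n) p" "T j p" "T (j + 1) p"] dist_orbit[of j "j + 1"]
    by (simp add: a_def)
  ultimately have "a j + b j \<le> 2 * K + 2 * \<delta> + dist p (T 1 p)"
    using j by linarith
  moreover have "gromov_product (T j p) (T (- n) p) (T n p) \<le> C"
    using j by (intro between) auto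
  moreover have "dist (T (- n) p) (T n p) \<le> dist q (T (- n) p) + dist q (T n p)"
    by (simp add: dist_triangle3)
  ultimately have "dist q (T j p) \<le> 2 * K + 2 * \<delta> + dist p (T 1 p) + C"
    by (simp add: a_def b_def gromov_product_def dist_commute field_simps)
  then show ?thesis ..
qed

text \<open>
  The constant that \<open>near_axis\<close> gives for \<open>K = C + 2 \<delta>\<close>.
\<close>

definition axis_width :: real
  where "axis_width = 3 * C + 6 * \<delta> + dist p (T 1 p)"

text \<open>
  The axis and its image under \<open>g\<close> have the same two ends (possibly interchanged).  The base point
  \<open>g p\<close> of the image sees its own ends with bounded Gromov product, hence also those of the axis,
  since points far out at bounded distance \<open>B\<close> have large Gromov product.  The resulting bound is
  the same for all \<open>g\<close> and \<open>B\<close>.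
\<close>

lemma near_axis_if_same_ends:
  assumes g: "\<And>x y. dist (g x) (g y) = dist x y"
    and \<sigma>: "\<sigma> = 1 \<or> \<sigma> = - 1"
    and q: "q \<ge> 1"
    and B: "\<And>n. dist (g (T (q * n) p)) (T (\<sigma> * (q * n)) p) \<le> B"
  shows "\<exists>j. dist (g p) (T j p) \<le> axis_width"
proof -
  \<comment> \<open>At displacement beyond \<open>M\<close> from the base point, corresponding points of the two lines have a
    Gromov product exceeding every bounded one that occurs below.\<close>
  define M where "M = B + C + 3 * \<delta> + dist p (g p)"
  obtain N where N: "\<And>n. N \<le> \<bar>n\<bar> \<Longrightarrow> M + 1 \<le> dist p (T n p)"
    using escapes by blast
  define n where "n = q * \<bar>N\<bar>"
  have n: "N \<le> \<bar>n\<bar>" "N \<le> \<bar>- n\<bar>" "0 \<le> n"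
  proof -
    have "1 * \<bar>N\<bar> \<le> q * \<bar>N\<bar>"
      using q by (intro mult_right_mono) auto
    then show "N \<le> \<bar>n\<bar>" "N \<le> \<bar>- n\<bar>" "0 \<le> n"
      by (auto simp: n_def)
  qed
  define x where "x i = T (\<sigma> * i) p" for i
  define y where "y i = g (T i p)" for i
  have xy: "dist (y n) (x n) \<le> B" "dist (y (- n)) (x (- n)) \<le> B"
    using B[of "\<bar>N\<bar>"] B[of "- \<bar>N\<bar>"] by (simp_all add: x_def y_def n_def)
  have far: "M + 1 \<le> dist p (T n p)" "M + 1 \<le> dist p (T (- n) p)"
    using N[OF n(1)] N[OF n(2)] by auto
  have y: "gromov_product (g p) (y (- n)) (y n) \<le> C"
    using gromov_product_isometry[OF g] ends_apart[of n n] n by (simp add: y_def)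
  have dy: "dist (g p) (y i) = dist p (T i p)" for i
    by (simp add: y_def g)
  have close: "M + 1 - B \<le> gromov_product (g p) (x i) (y i)" if "i = n \<or> i = - n" for i
  proof -
    have "gromov_product (g p) (y i) (y i) \<le> gromov_product (g p) (y i) (x i) + dist (y i) (x i)"
      by (rule gromov_product_change)
    moreover have "gromov_product (g p) (y i) (y i) = dist p (T i p)"
      by (simp add: gromov_product_def dy)
    ultimately show ?thesis
      using that xy far by (auto simp: gromov_product_commute)
  qed
  have M: "C + 3 * \<delta> < M + 1 - B"
    by (simp add: M_def add_nonneg_pos)
  have "gromov_product (g p) (x n) (y (- n)) \<le> C + \<delta>"
    using gromov_hyperbolicD[OF hyp, of "g p" "y n" "x n" "y (- n)"] y close[of n] M delta_nonneg
    by (auto simp: gromov_product_commute min_def split: if_splits)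
  then have K: "gromov_product (g p) (x n) (x (- n)) \<le> C + 2 * \<delta>"
    using gromov_hyperbolicD[OF hyp, of "g p" "x n" "x (- n)" "y (- n)"] close[of "- n"] M delta_nonneg
    by (auto simp: gromov_product_commute min_def split: if_splits)
  have dT: "C + 2 * \<delta> + \<delta> < dist (g p) (T i p)" if "i = n \<or> i = - n" for i
  proof -
    have "dist p (T i p) \<le> dist p (g p) + dist (g p) (T i p)"
      by (rule dist_triangle)
    moreover have "0 \<le> B"
      using B[of 0] by (meson dual_order.trans zero_le_dist)
    moreover have "M + 1 \<le> dist p (T i p)"
      using that far by auto
    ultimately show ?thesis
      unfolding M_def by linarith
  qed
  have "gromov_product (g p) (T (- n) p) (T n p) \<le> C + 2 * \<delta>"
    using K \<sigma> by (auto simp: x_def gromov_product_commute)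
  from near_axis[OF this _ _ n(3)] dT show ?thesis
    by (simp add: axis_width_def algebra_simps)
qed

text \<open>
  If \<open>g\<close> maps one end of the axis to an end of the axis, the elements
  \<open>T (- \<sigma> n) \<circ> g \<circ> T n\<close> all move the base point by a bounded amount.  By discreteness two of
  them agree, and then \<open>g\<close> conjugates a power of the translation to itself or to its inverse.  So
  \<open>g\<close> also respects the other end.
\<close>

lemma near_axis_if_common_end:
  assumes proper: "proper_space TYPE('a)"
    and sub: "subgroup G isometry_group" and pd: "properly_discontinuous G"
    and TG: "\<And>i. T i \<in> G" and g: "g \<in> G"
    and \<sigma>: "\<sigma> = 1 \<or> \<sigma> = - 1"
    and B: "\<And>n. 0 \<le> n \<Longrightarrow> dist (g (T n p)) (T (\<sigma> * n) p) \<le> B"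
  shows "\<exists>j. dist (g p) (T j p) \<le> axis_width"
proof -
  have g_dist: "dist (g x) (g y) = dist x y" for x y
    using subgroup.subset[OF sub] g by (auto simp: isometry_group_def)
  define f where "f n = T (- (\<sigma> * int n)) \<circ> g \<circ> T (int n)" for n
  have fG: "f n \<in> G" for n
    using subgroup.m_closed[OF sub subgroup.m_closed[OF sub TG g] TG]
    by (simp add: f_def isometry_group_def)
  have "dist p (f n p) \<le> B" for n
  proof -
    have "dist (f n p) p = dist (T (\<sigma> * int n) (f n p)) (T (\<sigma> * int n) p)"
      by (simp only: T_dist)
    also have "\<dots> \<le> B"
      using B[of "int n"] by (simp add: f_def)
    finally show ?thesis by (simp add: dist_commute)
  qed
  then have "f n p \<in> f n ` cball p B \<inter> cball p B" for n
    using order_trans[OF zero_le_dist B[of 0]] by auto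
  then have "range f \<subseteq> {h \<in> G. h ` cball p B \<inter> cball p B \<noteq> {}}"
    using fG by blast
  moreover have "finite {h \<in> G. h ` cball p B \<inter> cball p B \<noteq> {}}"
    using pd proper by (simp add: properly_discontinuous_def proper_space_def)
  ultimately have "finite (range f)"
    by (rule finite_subset)
  then have "\<not> inj f"
    using finite_imageD by auto
  then obtain n m where nm: "n < m" "f n = f m"
    by (metis injI linorder_neqE_nat)
  define q where "q = int m - int n"
  have q: "1 \<le> q"
    using nm by (simp add: q_def)
  have step: "g (T q x) = T (\<sigma> * q) (g x)" for x
  proof -
    have "T (\<sigma> * int m) (f n (T (- int n) x)) = T (\<sigma> * int m) (f m (T (- int n) x))"
      using nm by simp
    then have "T (\<sigma> * int m) (T (- (\<sigma> * int n)) (g x)) = g (T (int m) (T (- int n) x))"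
      by (simp add: f_def)
    then show ?thesis
      using T_add[of "\<sigma> * int m" "- (\<sigma> * int n)" "g x"] T_add[of "int m" "- int n" x]
      by (simp add: q_def algebra_simps)
  qed
  have pos: "g (T (q * int k) x) = T (\<sigma> * (q * int k)) (g x)" for k x
  proof (induction k)
    case (Suc k)
    have "g (T (q * int (Suc k)) x) = g (T q (T (q * int k) x))"
      using T_add[of q "q * int k" x] by (simp add: algebra_simps)
    also have "\<dots> = T (\<sigma> * q) (T (\<sigma> * (q * int k)) (g x))"
      by (simp only: step Suc)
    also have "\<dots> = T (\<sigma> * (q * int (Suc k))) (g x)"
      using T_add[of "\<sigma> * q" "\<sigma> * (q * int k)" "g x"] by (simp add: algebra_simps)
    finally show ?case .
  qed (simp add: T_0)
  have neg: "g (T (- (q * int k)) x) = T (- (\<sigma> * (q * int k))) (g x)" for k x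
  proof -
    have "T (\<sigma> * (q * int k)) (g (T (- (q * int k)) x)) = g x"
      using pos[of k "T (- (q * int k)) x"] by simp
    then show ?thesis
      by (metis T_cancel(1))
  qed
  have "dist (g (T (q * n) p)) (T (\<sigma> * (q * n)) p) \<le> dist (g p) p" for n
  proof (cases n rule: int_cases2)
    case (nonneg k)
    then show ?thesis by (simp add: pos T_dist)
  next
    case (nonpos k)
    then show ?thesis by (simp add: neg T_dist)
  qed
  from near_axis_if_same_ends[OF g_dist \<sigma> q this] show ?thesis .
qed

end

context loxodromic
begin

text \<open>
  If the product is unbounded, a half axis and the image of a half axis tend to the same end, hence
  fellow travel, and \<open>g p\<close> is near the axis.
\<close>

lemma bounded_product_half_axes:
  assumes proper: "proper_space TYPE('a)"
    and sub: "subgroup G isometry_group" and pd: "properly_discontinuous G"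
    and TG: "\<And>i. T i \<in> G" and g: "g \<in> G"
    and \<sigma>: "\<sigma> = 1 \<or> \<sigma> = - 1"
    and off: "\<And>j. axis_width < dist (g p) (T j p)"
  shows "\<exists>R. \<forall>i\<ge>0. \<forall>j\<ge>0. gromov_product p (g (T i p)) (T (\<sigma> * j) p) \<le> R"
proof (rule ccontr)
  assume "\<not> ?thesis"
  then have unb: "\<exists>i\<ge>0. \<exists>j\<ge>0. R < gromov_product p (g (T i p)) (T (\<sigma> * j) p)" for R
    by (meson not_le)
  have g_dist: "dist (g x) (g y) = dist x y" for x y
    using subgroup.subset[OF sub] g by (auto simp: isometry_group_def)
  define A where "A = dist p (g p)"
  have A0: "0 \<le> A" by (simp add: A_def)
  define f where "f i = dist p (T i p)" for i
  have d\<sigma>: "dist p (T (\<sigma> * i) p) = f i" for i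
    using \<sigma> dist_minus by (auto simp: f_def)
  have du: "dist p (g (T i p)) \<le> f i + A" for i
    using dist_triangle[of p "g (T i p)" "g p"] by (simp add: g_dist A_def f_def)
  have "dist (g (T s p)) (T (\<sigma> * s) p) \<le> 4 * (C + A) + 4 * \<delta>" if "0 \<le> s" for s
  proof (rule fellow_travel[OF hyp, where u = "\<lambda>i. g (T i p)" and v = "\<lambda>i. T (\<sigma> * i) p" and f = f
        and ?s0.0 = 0 and p = p])
    fix s t :: int
    assume st: "0 \<le> s" "s \<le> t"
    have "gromov_product (g p) (g (T s p)) (g (T t p)) = gromov_product p (T s p) (T t p)"
      by (rule gromov_product_isometry) (rule g_dist)
    then show "f s - (C + A) \<le> gromov_product p (g (T s p)) (g (T t p))"
      using same_side[OF st] gromov_product_change_base[of "g p" "g (T s p)" "g (T t p)" p]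
      by (simp add: f_def A_def)
    have "f s - C \<le> gromov_product p (T (\<sigma> * s) p) (T (\<sigma> * t) p)"
      using \<sigma> same_side[OF st] loxodromic.same_side[OF reversed st] dist_minus[of s]
      by (auto simp: f_def)
    then show "f s - (C + A) \<le> gromov_product p (T (\<sigma> * s) p) (T (\<sigma> * t) p)"
      using A0 by linarith
  next
    show "dist p (g (T s p)) \<le> f s + (C + A)"
      using du[of s] C_nonneg by linarith
    show "dist p (T (\<sigma> * s) p) \<le> f s + (C + A)"
      using C_nonneg A0 by (simp add: d\<sigma>)
    fix M
    \<comment> \<open>A product beyond \<open>D + A\<close> can only be attained at parameters larger than \<open>s\<close>.\<close>
    define D where "D = Max (f ` {0..s})"
    have D: "f i \<le> D" if "0 \<le> i" "i \<le> s" for i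
      unfolding D_def using that by (intro Max_ge) auto
    obtain i j where ij: "0 \<le> i" "0 \<le> j"
      "max M (D + A) < gromov_product p (g (T i p)) (T (\<sigma> * j) p)"
      using unb by blast
    have "D < f i" "D < f j"
      using ij gromov_product_le_dist[of p "g (T i p)" "T (\<sigma> * j) p"] du[of i]
        gromov_product_le_dist'[of p "g (T i p)" "T (\<sigma> * j) p"] d\<sigma>[of j] A0 by simp_all
    then have "s \<le> i" "s \<le> j"
      using D ij by force+
    with ij show "\<exists>i\<ge>s. \<exists>j\<ge>s. M \<le> gromov_product p (g (T i p)) (T (\<sigma> * j) p)"
      by (intro exI[of _ i] conjI exI[of _ j]) auto
  qed (use that in auto)
  from near_axis_if_common_end[OF proper sub pd TG g \<sigma> this] off show False
    by (meson not_le)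
qed

lemma bounded_product_if_off_axis:
  assumes proper: "proper_space TYPE('a)"
    and sub: "subgroup G isometry_group" and pd: "properly_discontinuous G"
    and TG: "\<And>i. T i \<in> G" and g: "g \<in> G"
    and off: "\<And>j. axis_width < dist (g p) (T j p)"
  shows "\<exists>R. \<forall>i j. gromov_product p (g (T i p)) (T j p) \<le> R"
proof -
  interpret rev: loxodromic p \<delta> C "\<lambda>i. T (- i)"
    by (rule reversed)
  have w: "rev.axis_width = axis_width"
    by (simp add: rev.axis_width_def axis_width_def dist_minus)
  obtain R1 where R1: "\<And>i j. 0 \<le> i \<Longrightarrow> 0 \<le> j \<Longrightarrow> gromov_product p (g (T i p)) (T (1 * j) p) \<le> R1"
    using bounded_product_half_axes[OF proper sub pd TG g _ off, of 1] by auto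
  obtain R2 where R2: "\<And>i j. 0 \<le> i \<Longrightarrow> 0 \<le> j \<Longrightarrow> gromov_product p (g (T i p)) (T (- 1 * j) p) \<le> R2"
    using bounded_product_half_axes[OF proper sub pd TG g _ off, of "- 1"] by auto
  obtain R3 where R3: "\<And>i j. 0 \<le> i \<Longrightarrow> 0 \<le> j \<Longrightarrow> gromov_product p (g (T (- i) p)) (T (- (1 * j)) p) \<le> R3"
    using rev.bounded_product_half_axes[OF proper sub pd TG g _, of 1] off w by auto
  obtain R4 where R4: "\<And>i j. 0 \<le> i \<Longrightarrow> 0 \<le> j \<Longrightarrow> gromov_product p (g (T (- i) p)) (T (- (- 1 * j)) p) \<le> R4"
    using rev.bounded_product_half_axes[OF proper sub pd TG g _, of "- 1"] off w by auto
  have "gromov_product p (g (T i p)) (T j p) \<le> max (max R1 R2) (max R3 R4)" for i j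
  proof -
    consider "0 \<le> i" "0 \<le> j" | "0 \<le> i" "0 \<le> - j" | "0 \<le> - i" "0 \<le> - j" | "0 \<le> - i" "0 \<le> j"
      by linarith
    then show ?thesis
      using R1[of i j] R2[of i "- j"] R3[of "- i" "- j"] R4[of "- i" j] by cases auto
  qed
  then show ?thesis by blast
qed

end

section \<open>Limit points of an orbit close to the axis\<close>

lemma ray_dist:
  assumes "geodesic_ray \<rho>" "0 \<le> s"
  shows "s - dist p (\<rho> 0) \<le> dist p (\<rho> s)" "dist p (\<rho> s) \<le> s + dist p (\<rho> 0)"
proof -
  have "dist (\<rho> 0) (\<rho> s) = s"
    using assms by (simp add: geodesic_ray_def)
  then show "s - dist p (\<rho> 0) \<le> dist p (\<rho> s)" "dist p (\<rho> s) \<le> s + dist p (\<rho> 0)"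
    using dist_triangle[of p "\<rho> s" "\<rho> 0"] dist_triangle[of "\<rho> 0" "\<rho> s" p]
    by (simp_all add: dist_commute)
qed

lemma ray_product:
  assumes "geodesic_ray \<rho>" "0 \<le> s" "s \<le> t"
  shows "s - dist p (\<rho> 0) \<le> gromov_product p (\<rho> s) (\<rho> t)"
proof -
  have "dist (\<rho> s) (\<rho> t) = t - s"
    using assms by (simp add: geodesic_ray_def)
  then show ?thesis
    using ray_dist(1)[of \<rho> s p] ray_dist(1)[of \<rho> t p] assms by (simp add: gromov_product_def)
qed

lemma asymptotic_product_unbounded:
  assumes "(\<rho>, \<rho>') \<in> asymptotic"
  shows "eventually (\<lambda>t. M \<le> gromov_product p (\<rho> t) (\<rho>' t)) at_top"
proof -
  obtain K where K: "\<And>t. 0 \<le> t \<Longrightarrow> dist (\<rho> t) (\<rho>' t) \<le> K"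
    and rays: "geodesic_ray \<rho>" "geodesic_ray \<rho>'"
    using assms by (auto simp: asymptotic_def)
  show ?thesis
    using eventually_ge_at_top[of 0] eventually_ge_at_top[of "M + (dist p (\<rho> 0) + dist p (\<rho>' 0) + K) / 2"]
  proof eventually_elim
    case (elim t)
    then show ?case
      using ray_dist(1)[OF rays(1), of t p] ray_dist(1)[OF rays(2), of t p] K[of t]
      unfolding gromov_product_def by (simp add: field_simps)
  qed
qed

lemma equiv_asymptotic: "equiv (Collect geodesic_ray) asymptotic"
proof (rule equivI)
  show "asymptotic \<subseteq> Collect geodesic_ray \<times> Collect geodesic_ray"
    by (auto simp: asymptotic_def)
  show "refl_on (Collect geodesic_ray) asymptotic"
    by (auto simp: asymptotic_def refl_on_def)
  show "sym asymptotic"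
    by (auto simp: asymptotic_def sym_def dist_commute)
  show "trans asymptotic"
  proof (rule transI)
    fix x y z
    assume "(x, y) \<in> asymptotic" "(y, z) \<in> asymptotic"
    then obtain A B where "geodesic_ray x" "geodesic_ray z"
      "\<And>t. 0 \<le> t \<Longrightarrow> dist (x t) (y t) \<le> A" "\<And>t. 0 \<le> t \<Longrightarrow> dist (y t) (z t) \<le> B"
      by (auto simp: asymptotic_def)
    moreover from this have "\<forall>t\<ge>0. dist (x t) (z t) \<le> A + B"
      by (meson add_mono dist_triangle order_trans)
    ultimately show "(x, z) \<in> asymptotic"
      by (auto simp: asymptotic_def)
  qed
qed

lemma Liminf_ereal_ge_eventually:
  assumes "ereal r \<le> Liminf F (\<lambda>t. ereal (f t))"
  shows "eventually (\<lambda>t. r - 1 < f t) F"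
proof -
  have "ereal (r - 1) < Liminf F (\<lambda>t. ereal (f t))"
    using assms by (rule less_le_trans[rotated]) simp
  then show ?thesis
    by (auto dest!: less_LiminfD)
qed

context loxodromic
begin

text \<open>
  Convergence to the end, stated for a ray that may start anywhere.  The other end is the forward
  end of the reversed action.
\<close>

definition ray_to_forward_end :: "(real \<Rightarrow> 'a) \<Rightarrow> bool"
  where "ray_to_forward_end \<rho> \<longleftrightarrow> (\<forall>M. \<exists>t\<ge>0. \<exists>n\<ge>0. M \<le> gromov_product p (\<rho> t) (T n p))"

text \<open>
  Points far out on the forward half axis have large products with each other.  So rays that have
  large products with such points also have large products with each other.
\<close>

lemma rays_to_forward_end_asymptotic:
  assumes rays: "geodesic_ray \<rho>" "geodesic_ray \<rho>'"
    and ends: "ray_to_forward_end \<rho>" "ray_to_forward_end \<rho>'"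
  shows "(\<rho>, \<rho>') \<in> asymptotic"
proof -
  define D where "D = dist p (\<rho> 0) + dist p (\<rho>' 0)"
  have D: "dist p (\<rho> 0) \<le> D" "dist p (\<rho>' 0) \<le> D"
    by (auto simp: D_def)
  have "dist (\<rho> s) (\<rho>' s) \<le> 4 * D + 4 * \<delta>" if "0 \<le> s" for s
  proof (rule fellow_travel[OF hyp, where f = "\<lambda>s. s" and ?s0.0 = 0 and p = p])
    fix M
    define M' where "M' = max M (s + D) + C + 2 * \<delta>"
    have M': "M \<le> M' - C - 2 * \<delta>" "s + D \<le> M'"
      using C_nonneg delta_nonneg by (auto simp: M'_def)
    obtain t n where tn: "0 \<le> t" "0 \<le> n" "M' \<le> gromov_product p (\<rho> t) (T n p)"
      using ends(1) unfolding ray_to_forward_end_def by blast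
    obtain t' n' where tn': "0 \<le> t'" "0 \<le> n'" "M' \<le> gromov_product p (\<rho>' t') (T n' p)"
      using ends(2) unfolding ray_to_forward_end_def by blast
    have "M' \<le> dist p (T n p)" "M' \<le> dist p (T n' p)"
      using tn tn' gromov_product_le_dist' order_trans by blast+
    then have "M' - C \<le> gromov_product p (T n p) (T n' p)"
      using same_side[of n n'] same_side[of n' n] tn tn'
      by (cases "n \<le> n'") (auto simp: gromov_product_commute)
    then have "M' - C - \<delta> \<le> gromov_product p (\<rho> t) (T n' p)"
      using gromov_hyperbolicD[OF hyp, of p "\<rho> t" "T n p" "T n' p"] tn C_nonneg by linarith
    then have "M' - C - 2 * \<delta> \<le> gromov_product p (\<rho> t) (\<rho>' t')"
      using gromov_hyperbolicD[OF hyp, of p "\<rho> t" "T n' p" "\<rho>' t'"] tn'(3) C_nonneg delta_nonneg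
      by (auto simp: gromov_product_commute min_def split: if_splits)
    then have "M \<le> gromov_product p (\<rho> t) (\<rho>' t')"
      using M' by linarith
    moreover have "s \<le> t"
      using tn gromov_product_le_dist[of p "\<rho> t" "T n p"] ray_dist(2)[OF rays(1) tn(1), of p] M'(2) D
      by linarith
    moreover have "s \<le> t'"
      using tn' gromov_product_le_dist[of p "\<rho>' t'" "T n' p"] ray_dist(2)[OF rays(2) tn'(1), of p] M'(2) D
      by linarith
    ultimately show "\<exists>i\<ge>s. \<exists>j\<ge>s. M \<le> gromov_product p (\<rho> i) (\<rho>' j)"
      by blast
  next
    show "dist p (\<rho> s) \<le> s + D" "dist p (\<rho>' s) \<le> s + D"
      using ray_dist(2)[OF rays(1) that, of p] ray_dist(2)[OF rays(2) that, of p] D by linarith+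
  next
    fix s t :: real
    assume st: "0 \<le> s" "s \<le> t"
    show "s - D \<le> gromov_product p (\<rho> s) (\<rho> t)" "s - D \<le> gromov_product p (\<rho>' s) (\<rho>' t)"
      using ray_product[OF rays(1) st, of p] ray_product[OF rays(2) st, of p] D by linarith+
  qed (rule that)
  then show ?thesis
    using rays by (auto simp: asymptotic_def)
qed

text \<open>
  A neighbourhood of all boundary points other than the two ends of the axis that misses the
  \<open>W\<close>-neighbourhood of the axis; it shows that these boundary points are not limit points of an
  orbit close to the axis.
\<close>

definition off_axis_region :: "real \<Rightarrow> ('a + (real \<Rightarrow> 'a) set) set"
  where "off_axis_region W =
    Inl ` {y. W < infdist y (range (\<lambda>n. T n p))} \<union>
    Inr ` {\<eta> \<in> boundary. \<exists>\<rho>\<in>\<eta>. \<exists>R. \<forall>t\<ge>0. \<forall>n. gromov_product p (\<rho> t) (T n p) \<le> R}"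

lemma off_axis_region_InrI:
  assumes "\<eta> \<in> boundary" "\<rho> \<in> \<eta>" "\<And>t n. 0 \<le> t \<Longrightarrow> gromov_product p (\<rho> t) (T n p) \<le> R"
  shows "Inr \<eta> \<in> off_axis_region W"
  unfolding off_axis_region_def using assms by blast

text \<open>
  A point whose product with \<open>\<eta>\<close> is large has, up to \<open>\<delta>\<close>, the same bounded products with the axis
  as the rays of \<open>\<eta>\<close>; but a point near the axis has a large product with some point of the axis.
\<close>

lemma bordification_open_off_axis_region: "bordification_open p (off_axis_region W)"
  unfolding bordification_open_def
proof (intro conjI allI impI)
  show "off_axis_region W \<subseteq> range Inl \<union> Inr ` boundary"
    by (auto simp: off_axis_region_def)
  have "Inl -` off_axis_region W = {y. W < infdist y (range (\<lambda>n. T n p))}"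
    by (auto simp: off_axis_region_def)
  then show "open (Inl -` off_axis_region W)"
    by (simp add: open_Collect_less continuous_intros)
next
  fix \<eta>
  assume "Inr \<eta> \<in> off_axis_region W"
  then obtain \<rho> R where \<eta>: "\<eta> \<in> boundary" "\<rho> \<in> \<eta>"
    and R: "\<And>t n. 0 \<le> t \<Longrightarrow> gromov_product p (\<rho> t) (T n p) \<le> R"
    by (auto simp: off_axis_region_def)
  \<comment> \<open>The summand 3 covers the loss of 1 in the lower limit, the loss of 1 in the infimal distance to
    the axis, and strictness; \<open>2 \<delta>\<close> covers two uses of the hyperbolic inequality.\<close>
  define r where "r = R + \<bar>W\<bar> + 2 * \<delta> + 3"
  have rW: "R < r - 2 - \<delta> - W" "R < r - 1 - 2 * \<delta>"
    using delta_nonneg by (auto simp: r_def)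
  have transfer: "\<exists>t\<ge>max 0 t0. r - 1 - \<delta> \<le> gromov_product p (\<rho> t) (z t)"
    if \<gamma>: "\<gamma> \<in> \<eta>" and lim: "ereal r \<le> Liminf at_top (\<lambda>t. ereal (gromov_product p (\<gamma> t) (z t)))"
    for \<gamma> z t0
  proof -
    have "(\<rho>, \<gamma>) \<in> asymptotic"
      using quotient_eq_iff[OF equiv_asymptotic, of \<eta> \<eta> \<rho> \<gamma>] \<eta> \<gamma> by (simp add: boundary_def)
    from asymptotic_product_unbounded[OF this, of r p] Liminf_ereal_ge_eventually[OF lim]
      eventually_ge_at_top[of "max 0 t0"]
    have "eventually (\<lambda>t. max 0 t0 \<le> t \<and> r - 1 - \<delta> \<le> gromov_product p (\<rho> t) (z t)) at_top"
    proof eventually_elim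
      case (elim t)
      then show ?case
        using gromov_hyperbolicD[OF hyp, of p "\<rho> t" "\<gamma> t" "z t"] by auto
    qed
    then show ?thesis
      by (auto dest: eventually_happens)
  qed
  have "boundary_nhd p \<eta> r \<subseteq> off_axis_region W"
  proof
    fix x
    assume "x \<in> boundary_nhd p \<eta> r"
    then consider (inside) y \<gamma> where "x = Inl y" "\<gamma> \<in> \<eta>"
        "ereal r \<le> Liminf at_top (\<lambda>t. ereal (gromov_product p (\<gamma> t) y))"
      | (bdry) \<zeta> \<gamma> \<gamma>' where "x = Inr \<zeta>" "\<zeta> \<in> boundary" "\<gamma> \<in> \<eta>" "\<gamma>' \<in> \<zeta>"
        "ereal r \<le> Liminf at_top (\<lambda>t. ereal (gromov_product p (\<gamma> t) (\<gamma>' t)))"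
      unfolding boundary_nhd_def by blast
    then show "x \<in> off_axis_region W"
    proof cases
      case inside
      obtain t where t: "0 \<le> t" "r - 1 - \<delta> \<le> gromov_product p (\<rho> t) y"
        using transfer[OF inside(2,3), of 0] by auto
      have "W < infdist y (range (\<lambda>n. T n p))"
      proof (rule ccontr)
        assume "\<not> ?thesis"
        then have "infdist y (range (\<lambda>n. T n p)) < W + 1"
          by simp
        then obtain n where "dist y (T n p) < W + 1"
          by (auto simp: infdist_def cINF_less_iff)
        then show False
          using gromov_product_change[of p "\<rho> t" y "T n p"] t R[OF t(1), of n] rW by linarith
      qed
      then show ?thesis
        by (auto simp: off_axis_region_def inside)
    next
      case bdry
      have ray: "geodesic_ray \<gamma>'"
        using bdry(2,4) in_quotient_imp_subset[OF equiv_asymptotic, of \<zeta>]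
        by (auto simp: boundary_def)
      have "gromov_product p (\<gamma>' t0) (T n p) \<le> r + 2 * dist p (\<gamma>' 0)" if "0 \<le> t0" for t0 n
      proof (rule ccontr)
        assume "\<not> ?thesis"
        then have large: "r + 2 * dist p (\<gamma>' 0) < gromov_product p (\<gamma>' t0) (T n p)"
          by simp
        then have t0: "r + dist p (\<gamma>' 0) < t0"
          using gromov_product_le_dist[of p "\<gamma>' t0" "T n p"] ray_dist(2)[OF ray that, of p]
          by linarith
        obtain t where t: "0 \<le> t" "t0 \<le> t" "r - 1 - \<delta> \<le> gromov_product p (\<rho> t) (\<gamma>' t)"
          using transfer[OF bdry(3,5), of t0] by auto
        have "r \<le> gromov_product p (\<gamma>' t) (\<gamma>' t0)"
          using ray_product[OF ray that t(2), of p] t0 by (simp add: gromov_product_commute)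
        moreover have "r \<le> gromov_product p (\<gamma>' t0) (T n p)"
          using large zero_le_dist[of p "\<gamma>' 0"] by linarith
        ultimately have "r - \<delta> \<le> gromov_product p (\<gamma>' t) (T n p)"
          using gromov_hyperbolicD[OF hyp, of p "\<gamma>' t" "\<gamma>' t0" "T n p"] by linarith
        then have "r - 1 - 2 * \<delta> \<le> gromov_product p (\<rho> t) (T n p)"
          using gromov_hyperbolicD[OF hyp, of p "\<rho> t" "\<gamma>' t" "T n p"] t(3) delta_nonneg
          by linarith
        then show False
          using R[OF t(1), of n] rW by linarith
      qed
      from off_axis_region_InrI[OF bdry(2,4) this] show ?thesis
        by (simp add: bdry)
    qed
  qed
  then show "\<exists>r. boundary_nhd p \<eta> r \<subseteq> off_axis_region W" ..
qed

text \<open>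
  Otherwise \<open>off_axis_region W\<close> would be a neighbourhood of \<open>\<xi>\<close> that contains no orbit point.
\<close>

lemma limit_point_is_end:
  assumes near: "\<And>g. g \<in> G \<Longrightarrow> \<exists>j. dist (g p) (T j p) \<le> W"
    and \<xi>: "\<xi> \<in> limit_set p G" and \<rho>: "\<rho> \<in> \<xi>"
  shows "ray_to_forward_end \<rho> \<or> loxodromic.ray_to_forward_end p (\<lambda>i. T (- i)) \<rho>"
proof (rule ccontr)
  interpret rev: loxodromic p \<delta> C "\<lambda>i. T (- i)"
    by (rule reversed)
  assume neg: "\<not> ?thesis"
  then obtain M where M: "\<And>t n. 0 \<le> t \<Longrightarrow> 0 \<le> n \<Longrightarrow> gromov_product p (\<rho> t) (T n p) < M"
    unfolding ray_to_forward_end_def by (meson not_le)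
  obtain M' where M': "\<And>t n. 0 \<le> t \<Longrightarrow> 0 \<le> n \<Longrightarrow> gromov_product p (\<rho> t) (T (- n) p) < M'"
    using neg unfolding rev.ray_to_forward_end_def by (meson not_le)
  have "gromov_product p (\<rho> t) (T n p) \<le> max M M'" if "0 \<le> t" for t n
    using M[OF that, of n] M'[OF that, of "- n"] by (cases "0 \<le> n") auto
  moreover have "\<xi> \<in> boundary"
    using \<xi> by (simp add: limit_set_def)
  ultimately have "Inr \<xi> \<in> off_axis_region W"
    by (intro off_axis_region_InrI[OF _ \<rho>])
  moreover have "Inr \<xi> \<in> bordification p derived_set_of (Inl ` (\<lambda>g. g p) ` G)"
    using \<xi> by (simp add: limit_set_def)
  ultimately have "\<exists>y. y \<noteq> Inr \<xi> \<and> y \<in> Inl ` (\<lambda>g. g p) ` G \<and> y \<in> off_axis_region W"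
    using bordification_open_off_axis_region[of W]
    by (simp only: in_derived_set_of openin_bordification)
  then obtain g where g: "g \<in> G" "(Inl (g p) :: 'a + (real \<Rightarrow> 'a) set) \<in> off_axis_region W"
    by auto
  obtain j where "dist (g p) (T j p) \<le> W"
    using near[OF g(1)] by blast
  moreover have "infdist (g p) (range (\<lambda>n. T n p)) \<le> dist (g p) (T j p)"
    by (intro infdist_le) auto
  ultimately show False
    using g(2) by (auto simp: off_axis_region_def)
qed

text \<open>
  A limit point is determined by which of the two ends of the axis its rays converge to.
\<close>

lemma elementary_if_orbit_near_axis:
  assumes near: "\<And>g. g \<in> G \<Longrightarrow> \<exists>j. dist (g p) (T j p) \<le> W"
  shows "\<not> non_elementary p G"
proof -
  interpret rev: loxodromic p \<delta> C "\<lambda>i. T (- i)"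
    by (rule reversed)
  define ray where "ray \<xi> = (SOME \<rho>. \<rho> \<in> \<xi>)" for \<xi> :: "(real \<Rightarrow> 'a) set"
  have ray: "ray \<xi> \<in> \<xi>" "geodesic_ray (ray \<xi>)" "\<xi> \<in> boundary" if "\<xi> \<in> limit_set p G" for \<xi>
  proof -
    show "\<xi> \<in> boundary"
      using that by (simp add: limit_set_def)
    then have "\<xi> \<in> Collect geodesic_ray // asymptotic"
      by (simp add: boundary_def)
    then have "\<xi> \<noteq> {}" "\<xi> \<subseteq> Collect geodesic_ray"
      using in_quotient_imp_non_empty[OF equiv_asymptotic] in_quotient_imp_subset[OF equiv_asymptotic]
      by auto
    moreover from this show "ray \<xi> \<in> \<xi>"
      unfolding ray_def by (metis ex_in_conv someI)
    ultimately show "geodesic_ray (ray \<xi>)"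
      by auto
  qed
  have ends: "ray_to_forward_end (ray \<xi>) \<or> rev.ray_to_forward_end (ray \<xi>)"
    if "\<xi> \<in> limit_set p G" for \<xi>
    by (rule limit_point_is_end[OF _ that ray(1)[OF that]]) (rule near)
  have "inj_on (\<lambda>\<xi>. ray_to_forward_end (ray \<xi>)) (limit_set p G)"
  proof (rule inj_onI)
    fix \<xi> \<eta>
    assume \<xi>\<eta>: "\<xi> \<in> limit_set p G" "\<eta> \<in> limit_set p G"
      and same: "ray_to_forward_end (ray \<xi>) = ray_to_forward_end (ray \<eta>)"
    have "(ray \<xi>, ray \<eta>) \<in> asymptotic"
    proof (cases "ray_to_forward_end (ray \<xi>)")
      case True
      with same \<xi>\<eta> ray show ?thesis
        by (intro rays_to_forward_end_asymptotic) auto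
    next
      case False
      with same \<xi>\<eta> ray ends show ?thesis
        by (intro rev.rays_to_forward_end_asymptotic) blast+
    qed
    then show "\<xi> = \<eta>"
      using quotient_eq_iff[OF equiv_asymptotic] ray[OF \<xi>\<eta>(1)] ray[OF \<xi>\<eta>(2)]
      by (auto simp: boundary_def)
  qed
  then have "finite (limit_set p G)" "card (limit_set p G) \<le> card (UNIV :: bool set)"
    using inj_on_finite[of _ _ "UNIV :: bool set"] card_inj_on_le[of _ _ "UNIV :: bool set"] by auto
  then show ?thesis
    by (simp add: non_elementary_def)
qed

end

section \<open>Powers of a hyperbolic isometry\<close>

lemma quadratic_less_power2:
  fixes a b :: real
  shows "\<exists>k. a + b * real k < 2 ^ k"
proof -
  define m where "m = \<bar>a\<bar> + 2 * \<bar>b\<bar>"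
  obtain j :: nat where j: "m < real j + 1"
    using reals_Archimedean2[of m] by (meson less_add_one less_trans)
  have "a + b * real (2 * j) \<le> \<bar>a\<bar> + 2 * \<bar>b\<bar> * real j"
    by (intro add_mono) (auto intro: mult_right_mono)
  also have "\<dots> \<le> m * (real j + 1)"
    by (simp add: m_def algebra_simps)
  also have "\<dots> < (real j + 1) * (real j + 1)"
    using j by (intro mult_strict_right_mono) auto
  also have "\<dots> \<le> 2 ^ j * 2 ^ j"
    using Bernoulli_inequality[of 1 j] by (intro mult_mono) (auto simp: add.commute)
  also have "\<dots> = 2 ^ (2 * j)"
    by (simp add: mult_2 power_add)
  finally show ?thesis by blast
qed

text \<open>
  Displacements of the powers of a hyperbolic isometry grow linearly, so for some exponent \<open>N\<close>
  doubling adds more than \<open>4 \<delta>\<close> to the displacement.  The four point inequality then shows that the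
  displacements \<open>b n\<close> of the powers with exponents \<open>N n\<close> are increasing, by a definite amount in each
  step, and hence additive up to the error \<open>b 1 + 2 \<delta>\<close>.  The other exponents differ from these by
  less than \<open>N\<close>.
\<close>

lemma loxodromic_powers:
  fixes p :: "'a::metric_space"
  assumes hyp: "gromov_hyperbolic \<delta> TYPE('a)" and \<gamma>: "hyperbolic_isometry p \<gamma>"
  shows "\<exists>C. loxodromic p \<delta> C (\<lambda>i::int. \<gamma> [^]\<^bsub>isometry_group\<^esub> i)"
proof -
  interpret I: group "isometry_group :: ('a \<Rightarrow> 'a) monoid"
    by (rule group_isometry_group)
  define T where "T i = \<gamma> [^]\<^bsub>isometry_group\<^esub> i" for i :: int
  have \<gamma>_carrier: "\<gamma> \<in> carrier isometry_group"
    using \<gamma> by (simp add: hyperbolic_isometry_def)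
  have T_carrier: "T i \<in> carrier isometry_group" for i
    using \<gamma>_carrier by (simp add: T_def)
  have T_0: "T 0 x = x" for x
    by (simp add: T_def isometry_group_def int_pow_def2)
  have T_add: "T (i + j) x = T i (T j x)" for i j x
    using I.int_pow_mult[OF \<gamma>_carrier, of i j] by (simp add: T_def isometry_group_def)
  have T_dist: "dist (T i x) (T i y) = dist x y" for i x y
    using T_carrier[of i] by (simp add: isometry_group_def)
  define a where "a n = dist p (T n p)" for n
  have a: "dist (T i p) (T j p) = a (j - i)" for i j
    using T_dist[of i p "T (j - i) p"] T_add[of i "j - i" p] by (simp add: a_def)
  have a_0: "a 0 = 0" and a_nonneg: "0 \<le> a i" for i
    by (simp_all add: a_def T_0)
  have a_minus: "a (- i) = a i" for i
    using a[of i 0] a[of 0 i] by (simp add: dist_commute)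
  have a_add: "a (i + j) \<le> a i + a j" for i j
    using dist_triangle[of "T 0 p" "T (i + j) p" "T i p"] a[of 0 i] a[of 0 "i + j"] a[of i "i + j"]
    by simp
  obtain \<Lambda> c where \<Lambda>: "0 < \<Lambda>" and "\<And>n m. inverse \<Lambda> * \<bar>real_of_int (n - m)\<bar> - c \<le> dist (T n p) (T m p)"
    using \<gamma> by (auto simp: hyperbolic_isometry_def Let_def T_def)
  from this(2)[of 0] have lower: "inverse \<Lambda> * \<bar>real_of_int n\<bar> - c \<le> a n" for n
    by (metis T_0 a_def abs_minus_cancel diff_0 of_int_minus)
  have four: "a (k - i) + a (l - j) \<le> max (a (j - i) + a (l - k)) (a (l - i) + a (k - j)) + 2 * \<delta>"
    for i j k l
    using four_point[OF hyp, of "T i p" "T k p" "T j p" "T l p"] by (simp add: a)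
  have \<delta>: "0 \<le> \<delta>"
    by (rule gromov_hyperbolic_nonneg[OF hyp])
  obtain N :: int where N: "1 \<le> N" "a N + 4 * \<delta> + 1 \<le> a (2 * N)"
  proof (rule ccontr)
    assume "\<not> thesis"
    then have step: "a (2 * N) \<le> a N + 4 * \<delta> + 1" if "1 \<le> N" for N
      using that \<open>\<And>N. 1 \<le> N \<Longrightarrow> a N + 4 * \<delta> + 1 \<le> a (2 * N) \<Longrightarrow> thesis\<close> by force
    have up: "a (2 ^ k) \<le> a 1 + real k * (4 * \<delta> + 1)" for k
    proof (induction k)
      case (Suc k)
      then show ?case
        using step[of "2 ^ k"] by (simp add: algebra_simps)
    qed simp
    obtain k where "\<Lambda> * (a 1 + c) + \<Lambda> * (4 * \<delta> + 1) * real k < 2 ^ k"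
      using quadratic_less_power2 by blast
    then have "\<Lambda> * (a 1 + c + real k * (4 * \<delta> + 1)) < 2 ^ k"
      by (simp add: algebra_simps)
    then have "a 1 + c + real k * (4 * \<delta> + 1) < inverse \<Lambda> * 2 ^ k"
      using \<Lambda> by (simp add: field_simps)
    then show False
      using lower[of "2 ^ k"] up[of k] by simp
  qed
  define b where "b n = a (N * int n)" for n
  have b_gap: "b 1 + 4 * \<delta> + 1 \<le> b 2"
    using N by (simp add: b_def mult.commute)
  have b_step: "b n + 2 * \<delta> + 1 \<le> b (Suc n)" for n
  proof (induction n)
    case 0
    have "b 2 \<le> 2 * b 1"
      using a_add[of N N] by (simp add: b_def mult.commute)
    then show ?case
      using b_gap a_0 \<delta> by (simp add: b_def)
  next
    case (Suc n)
    have "b 2 + b (Suc n) \<le> max (b 1 + b n) (b (Suc (Suc n)) + b 1) + 2 * \<delta>"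
      using four[of "2 * N" 0 "N * int (Suc (Suc n))" N] by (simp add: b_def algebra_simps)
    then show ?case
      using Suc b_gap \<delta> by linarith
  qed
  have b_add: "b m + b n \<le> b (m + n) + b 1 + 2 * \<delta>" for m n
  proof (cases n)
    case 0
    then show ?thesis
      using \<delta> a_nonneg a_0 by (simp add: b_def)
  next
    case (Suc l)
    have "b (Suc m) + b n \<le> max (b m + b l) (b (m + n) + b 1) + 2 * \<delta>"
      using four[of "N * int (Suc m)" 0 "N * int (m + n)" "N * int m"] Suc
      by (simp add: b_def algebra_simps)
    then show ?thesis
      using b_step[of m] b_step[of l, folded Suc] \<delta> by linarith
  qed
  define D where "D = Max (a ` {0..N})"
  have D: "a r \<le> D" if "0 \<le> r" "r \<le> N" for r
    unfolding D_def using that by (intro Max_ge) auto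
  have a_near_add: "a m + a n \<le> a (m + n) + b 1 + 2 * \<delta> + 4 * D" if mn: "0 \<le> m" "0 \<le> n" for m n
  proof -
    define i r where "i = nat (m div N)" and "r = m mod N"
    define j s where "j = nat (n div N)" and "s = n mod N"
    have eq: "m = N * int i + r" "n = N * int j + s"
      using mn N by (simp_all add: i_def r_def j_def s_def pos_imp_zdiv_nonneg_iff)
    have "0 \<le> r" "r \<le> N" "0 \<le> s" "s \<le> N"
      using N by (simp_all add: r_def s_def order.strict_implies_order)
    then have "a r \<le> D" "a s \<le> D"
      using D by blast+
    moreover have "a m \<le> b i + a r" "a n \<le> b j + a s"
      using a_add[of "N * int i" r] a_add[of "N * int j" s] by (simp_all add: b_def eq)
    moreover have "b (i + j) \<le> a (m + n) + a (- (r + s))"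
      using a_add[of "m + n" "- (r + s)"] by (simp add: b_def eq algebra_simps)
    moreover have "a (- (r + s)) \<le> a r + a s"
      using a_add[of r s] a_minus[of "r + s"] by simp
    ultimately show ?thesis
      using b_add[of i j] by linarith
  qed
  have "loxodromic p \<delta> ((b 1 + 2 * \<delta> + 4 * D) / 2) T"
  proof
    fix m n :: int
    assume "0 \<le> m" "0 \<le> n"
    then show "gromov_product p (T (- m) p) (T n p) \<le> (b 1 + 2 * \<delta> + 4 * D) / 2"
      using a_near_add[of m n] a[of "- m" n] a_minus[of m]
      by (simp add: gromov_product_def a_def[symmetric] add.commute)
  next
    fix M
    define L where "L = \<lceil>\<Lambda> * (M + c)\<rceil>"
    have "M \<le> dist p (T n p)" if "L \<le> \<bar>n\<bar>" for n
    proof -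
      have "\<Lambda> * (M + c) \<le> \<bar>real_of_int n\<bar>"
        using that unfolding L_def by linarith
      then have "M + c \<le> inverse \<Lambda> * \<bar>real_of_int n\<bar>"
        using \<Lambda> by (simp add: field_simps)
      then show ?thesis
        using lower[of n] by (simp add: a_def)
    qed
    then show "\<exists>N. \<forall>n. N \<le> \<bar>n\<bar> \<longrightarrow> M \<le> dist p (T n p)"
      by blast
  qed (use hyp T_0 T_add T_dist in auto)
  then show ?thesis
    unfolding T_def by blast
qed

section \<open>Effect of a translation and its inverse on the distance\<close>

context loxodromic
begin

lemma translation_sum:
  "dist p (T k x) + dist p (T (- k) x) = 2 * dist p x + 2 * dist p (T k p)
    - 2 * gromov_product p (T k p) x - 2 * gromov_product p (T (- k) p) x"
  using T_dist[of "- k" p "T k x"] T_dist[of k p "T (- k) x"] dist_minus[of k]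
  by (simp add: gromov_product_def field_simps)

text \<open>
  Only one of the two Gromov products can be large, and it is at most the displacement.
\<close>

lemma translation_no_loss:
  assumes "0 \<le> k"
  shows "2 * dist p x - 2 * (C + \<delta>) \<le> dist p (T k x) + dist p (T (- k) x)"
proof -
  have "min (gromov_product p (T (- k) p) x) (gromov_product p x (T k p)) \<le> C + \<delta>"
    using gromov_hyperbolicD[OF hyp, of p "T (- k) p" x "T k p"] ends_apart[OF assms assms]
    by linarith
  moreover have "gromov_product p (T k p) x \<le> dist p (T k p)"
    "gromov_product p (T (- k) p) x \<le> dist p (T k p)"
    using gromov_product_le_dist[of p _ x] dist_minus[of k] by metis+
  ultimately show ?thesis
    unfolding translation_sum by (simp add: gromov_product_commute min_def split: if_splits)
qed

definition away_from_ends :: "real \<Rightarrow> 'a set"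
  where "away_from_ends R = {x. \<forall>i. gromov_product p (T i p) x \<le> R}"

lemma translation_gain:
  assumes "x \<in> away_from_ends R"
  shows "2 * dist p x + 2 * dist p (T k p) - 4 * R \<le> dist p (T k x) + dist p (T (- k) x)"
  unfolding translation_sum using assms by (simp add: away_from_ends_def) (smt (verit))

text \<open>
  If \<open>x\<close> points towards an end, then \<open>h x\<close> points towards the image of this end, which has bounded
  product with both ends.
\<close>

lemma away_from_ends_or_moved_away:
  assumes h: "\<And>x y. dist (h x) (h y) = dist x y"
    and R: "\<And>i j. gromov_product p (h (T i p)) (T j p) \<le> R"
  defines "R' \<equiv> R + \<delta> + dist p (h p)"
  shows "x \<in> away_from_ends R' \<or> h x \<in> away_from_ends R'"
proof (rule disjCI)
  assume "h x \<notin> away_from_ends R'"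
  then obtain j where j: "R' < gromov_product p (T j p) (h x)"
    by (auto simp: away_from_ends_def not_le)
  have "gromov_product p (T i p) x \<le> R'" for i
  proof -
    have "min (gromov_product p (h (T i p)) (h x)) (gromov_product p (h x) (T j p)) \<le> R + \<delta>"
      using gromov_hyperbolicD[OF hyp, of p "h (T i p)" "h x" "T j p"] R[of i j] by linarith
    then have "gromov_product p (h (T i p)) (h x) \<le> R + \<delta>"
      using j zero_le_dist[of p "h p"] unfolding R'_def gromov_product_commute[of p "h x"]
      by linarith
    then show ?thesis
      using gromov_product_change_base[of "h p" "h (T i p)" "h x" p]
        gromov_product_isometry[OF h, of p "T i p" x] by (simp add: R'_def)
  qed
  then show "x \<in> away_from_ends R'"
    by (simp add: away_from_ends_def)
qed

end

section \<open>Subadditive sequences\<close>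

text \<open>
  Fekete's lemma, for nonnegative sequences.
\<close>

lemma subadditive_convergent:
  fixes u :: "nat \<Rightarrow> real"
  assumes sub: "\<And>m n. u (m + n) \<le> u m + u n" and nonneg: "\<And>n. 0 \<le> u n"
  shows "convergent (\<lambda>n. 1 / real n * u n)"
proof -
  define L where "L = (INF n\<in>{1..}. u n / real n)"
  have bdd: "bdd_below ((\<lambda>n. u n / real n) ` {1..})"
    using nonneg by (intro bdd_belowI[of _ 0]) auto
  have mult: "u (q * N + r) \<le> real q * u N + u r" for q N r
  proof (induction q)
    case (Suc q)
    then show ?case
      using sub[of N "q * N + r"] by (simp add: algebra_simps)
  qed simp
  have "(\<lambda>n. u n / real n) \<longlonglongrightarrow> L"
  proof (rule LIMSEQ_I)
    fix e :: real
    assume e: "0 < e"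
    have "(INF n\<in>{1..}. u n / real n) < L + e / 2"
      using e by (simp add: L_def)
    then obtain N where N: "1 \<le> N" "u N / real N < L + e / 2"
      using cINF_less_iff[OF _ bdd] by auto
    define M where "M = Max (u ` {..N})"
    have M: "u r \<le> M" if "r \<le> N" for r
      unfolding M_def using that by (intro Max_ge) auto
    obtain n0 :: nat where n0: "2 * M / e < real n0"
      using reals_Archimedean2 by blast
    have "norm (u n / real n - L) < e" if n: "max 1 n0 \<le> n" for n
    proof -
      have "u n \<le> real (n div N) * u N + u (n mod N)"
        using mult[of "n div N" N "n mod N"] by simp
      also have "\<dots> \<le> real n / real N * u N + M"
        using N nonneg M[of "n mod N"] of_nat_div_le_of_nat[of n N, where ?'a = real]
        by (intro add_mono mult_right_mono) (auto simp: order.strict_implies_order)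
      finally have "u n / real n \<le> (real n / real N * u N + M) / real n"
        using n by (intro divide_right_mono) auto
      also have "\<dots> = u N / real N + M / real n"
        using n by (simp add: field_simps)
      also have "M / real n < e / 2"
      proof -
        have "2 * M / e < real n"
          using n0 n by linarith
        then show ?thesis
          using e n by (simp add: field_simps)
      qed
      finally have "u n / real n < L + e"
        using N(2) by linarith
      moreover have "L \<le> u n / real n"
        unfolding L_def using n bdd by (intro cINF_lower) auto
      ultimately show ?thesis
        by (simp add: abs_less_iff)
    qed
    then show "\<exists>no. \<forall>n\<ge>no. norm (u n / real n - L) < e"
      by blast
  qed
  then show ?thesis
    by (auto simp: convergent_def)
qed

section \<open>Expectations and convolutions\<close>

lemma integrable_pmf_iff_summable:
  fixes f :: "'b \<Rightarrow> real"
  shows "integrable (measure_pmf \<nu>) f \<longleftrightarrow> (\<lambda>x. pmf \<nu> x * f x) summable_on UNIV"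
proof -
  have "integrable (measure_pmf \<nu>) f \<longleftrightarrow> integrable (count_space UNIV) (\<lambda>x. pmf \<nu> x * f x)"
    unfolding measure_pmf_eq_density
    by (subst integrable_density) (auto simp: pmf_nonneg)
  also have "\<dots> \<longleftrightarrow> Infinite_Set_Sum.abs_summable_on (\<lambda>x. pmf \<nu> x * f x) UNIV"
    by (simp add: Infinite_Set_Sum.abs_summable_on_def)
  also have "\<dots> \<longleftrightarrow> (\<lambda>x. norm (pmf \<nu> x * f x)) summable_on UNIV"
    by (rule abs_summable_equivalent[symmetric])
  also have "\<dots> \<longleftrightarrow> (\<lambda>x. pmf \<nu> x * f x) summable_on UNIV"
    by (rule summable_on_iff_abs_summable_on_real[symmetric])
  finally show ?thesis .
qed

lemma summable_on_support:
  fixes f :: "'b \<Rightarrow> real"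
  assumes "set_pmf \<nu> \<subseteq> G"
  shows "(\<lambda>x. pmf \<nu> x * f x) summable_on G \<longleftrightarrow> integrable (measure_pmf \<nu>) f"
  unfolding integrable_pmf_iff_summable
  using assms by (intro summable_on_cong_neutral) (auto simp: set_pmf_iff)

text \<open>
  If the sum diverges, both sides are 0 by convention.
\<close>

lemma infsum_pmf_eq_expectation:
  fixes f :: "'b \<Rightarrow> real"
  assumes "set_pmf \<nu> \<subseteq> G"
  shows "(\<Sum>\<^sub>\<infinity>x\<in>G. pmf \<nu> x * f x) = measure_pmf.expectation \<nu> f"
proof (cases "integrable (measure_pmf \<nu>) f")
  case True
  then have "(\<lambda>x. norm (pmf \<nu> x * f x)) summable_on UNIV"
    unfolding integrable_pmf_iff_summable by (rule summable_on_iff_abs_summable_on_real[THEN iffD1])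
  then have "Infinite_Set_Sum.abs_summable_on (\<lambda>x. pmf \<nu> x * f x) UNIV"
    by (simp only: abs_summable_equivalent)
  then have "measure_pmf.expectation \<nu> f = (\<Sum>\<^sub>\<infinity>x. pmf \<nu> x * f x)"
    by (simp add: pmf_expectation_eq_infsetsum infsetsum_infsum)
  also have "\<dots> = (\<Sum>\<^sub>\<infinity>x\<in>G. pmf \<nu> x * f x)"
    using assms by (intro infsum_cong_neutral) (auto simp: set_pmf_iff)
  finally show ?thesis by simp
next
  case False
  then show ?thesis
    using summable_on_support[OF assms, of f] by (simp add: infsum_not_exists not_integrable_integral_eq)
qed

lemma expectation_mono_support:
  fixes f g :: "'b \<Rightarrow> real"
  assumes "integrable (measure_pmf \<nu>) f" "integrable (measure_pmf \<nu>) g"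
    and "\<And>x. x \<in> set_pmf \<nu> \<Longrightarrow> f x \<le> g x"
  shows "measure_pmf.expectation \<nu> f \<le> measure_pmf.expectation \<nu> g"
  using assms by (intro integral_mono_AE) (auto simp: AE_measure_pmf_iff)

lemma integrable_bound_support:
  fixes f g :: "'b \<Rightarrow> real"
  assumes "integrable (measure_pmf \<nu>) g" "\<And>x. x \<in> set_pmf \<nu> \<Longrightarrow> \<bar>f x\<bar> \<le> g x"
  shows "integrable (measure_pmf \<nu>) f"
proof (rule Bochner_Integration.integrable_bound[OF assms(1)])
  show "AE x in measure_pmf \<nu>. norm (f x) \<le> norm (g x)"
    using assms(2) by (force simp: AE_measure_pmf_iff)
qed auto

definition convolution :: "('a \<Rightarrow> 'a) pmf \<Rightarrow> ('a \<Rightarrow> 'a) pmf \<Rightarrow> ('a \<Rightarrow> 'a) pmf"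
  where "convolution \<nu> \<nu>' = map_pmf (\<lambda>(g, h). g \<circ> h) (pair_pmf \<nu> \<nu>')"

lemma convolution_bind: "convolution \<nu> \<nu>' = bind_pmf \<nu> (\<lambda>g. bind_pmf \<nu>' (\<lambda>h. return_pmf (g \<circ> h)))"
  by (simp add: convolution_def pair_pmf_def map_bind_pmf)

lemma convolution_assoc: "convolution (convolution \<nu> \<nu>') \<nu>'' = convolution \<nu> (convolution \<nu>' \<nu>'')"
  by (simp add: convolution_bind bind_assoc_pmf bind_return_pmf o_assoc)

lemma convolution_id: "convolution \<nu> (return_pmf id) = \<nu>" "convolution (return_pmf id) \<nu> = \<nu>"
  by (simp_all add: convolution_bind bind_return_pmf bind_return_pmf')

lemma convolution_power_Suc: "convolution_power \<nu> (Suc n) = convolution (convolution_power \<nu> n) \<nu>"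
  by (simp add: convolution_def)

lemma convolution_power_1: "convolution_power \<nu> (Suc 0) = \<nu>"
  by (simp only: convolution_power_Suc convolution_power.simps(1) convolution_id)

declare convolution_power.simps(2) [simp del]

lemma convolution_power_add:
  "convolution_power \<nu> (m + n) = convolution (convolution_power \<nu> m) (convolution_power \<nu> n)"
  by (induction n) (simp_all add: convolution_id convolution_power_Suc convolution_assoc)

lemma set_pmf_convolution: "set_pmf (convolution \<nu> \<nu>') = (\<lambda>(g, h). g \<circ> h) ` (set_pmf \<nu> \<times> set_pmf \<nu>')"
  by (simp add: convolution_def)

lemma pmf_convolution_ge: "pmf \<nu> g * pmf \<nu>' h \<le> pmf (convolution \<nu> \<nu>') (g \<circ> h)"
proof -
  have "pmf \<nu> g * pmf \<nu>' h = measure (pair_pmf \<nu> \<nu>') {(g, h)}"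
    by (simp only: pmf_pair measure_pmf_single)
  also have "\<dots> \<le> measure (pair_pmf \<nu> \<nu>') ((\<lambda>(g, h). g \<circ> h) -` {g \<circ> h})"
    by (intro measure_pmf.finite_measure_mono) auto
  also have "\<dots> = pmf (convolution \<nu> \<nu>') (g \<circ> h)"
    by (simp add: convolution_def pmf_map)
  finally show ?thesis .
qed

text \<open>
  Tonelli's theorem for real expectations, together with the integrability of the inner one.
\<close>

lemma expectation_pair_pmf_nonneg:
  fixes f :: "'b \<times> 'c \<Rightarrow> real"
  assumes nonneg: "\<And>z. 0 \<le> f z" and int: "integrable (pair_pmf \<nu> \<nu>') f"
    and inner: "\<And>x. x \<in> set_pmf \<nu> \<Longrightarrow> integrable \<nu>' (\<lambda>y. f (x, y))"
  shows "integrable \<nu> (\<lambda>x. measure_pmf.expectation \<nu>' (\<lambda>y. f (x, y)))" (is ?I)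
    and "measure_pmf.expectation (pair_pmf \<nu> \<nu>') f
      = measure_pmf.expectation \<nu> (\<lambda>x. measure_pmf.expectation \<nu>' (\<lambda>y. f (x, y)))" (is ?E)
proof -
  let ?F = "\<lambda>x. measure_pmf.expectation \<nu>' (\<lambda>y. f (x, y))"
  have F: "0 \<le> ?F x" for x
    using nonneg by simp
  have "ennreal (measure_pmf.expectation (pair_pmf \<nu> \<nu>') f) = (\<integral>\<^sup>+z. ennreal (f z) \<partial>pair_pmf \<nu> \<nu>')"
    using int nonneg by (intro nn_integral_eq_integral[symmetric]) auto
  also have "\<dots> = (\<integral>\<^sup>+x. \<integral>\<^sup>+y. ennreal (f (x, y)) \<partial>\<nu>' \<partial>\<nu>)"
    by (rule nn_integral_pair_pmf')
  also have "\<dots> = (\<integral>\<^sup>+x. ennreal (?F x) \<partial>\<nu>)"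
    using inner nonneg
    by (intro nn_integral_cong_AE) (auto simp: AE_measure_pmf_iff intro!: nn_integral_eq_integral)
  finally have eq: "(\<integral>\<^sup>+x. ennreal (?F x) \<partial>\<nu>) = ennreal (measure_pmf.expectation (pair_pmf \<nu> \<nu>') f)"
    by simp
  show ?I
    using F eq by (intro integrableI_nonneg) auto
  then have "ennreal (measure_pmf.expectation \<nu> ?F) = (\<integral>\<^sup>+x. ennreal (?F x) \<partial>\<nu>)"
    using F by (intro nn_integral_eq_integral[symmetric]) auto
  with eq show ?E
    using F nonneg by simp
qed

lemma integrable_pair_fst_snd:
  fixes f :: "'b \<Rightarrow> real" and f' :: "'c \<Rightarrow> real"
  assumes "integrable (measure_pmf A) f" "integrable (measure_pmf B) f'"
  shows "integrable (pair_pmf A B) (\<lambda>z. f (fst z) + f' (snd z))"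
    and "measure_pmf.expectation (pair_pmf A B) (\<lambda>z. f (fst z) + f' (snd z))
      = measure_pmf.expectation A f + measure_pmf.expectation B f'"
proof -
  have "integrable (map_pmf fst (pair_pmf A B)) f" "integrable (map_pmf snd (pair_pmf A B)) f'"
    using assms by (simp_all add: map_fst_pair_pmf map_snd_pair_pmf del: integrable_map_pmf_eq)
  then have i: "integrable (pair_pmf A B) (\<lambda>z. f (fst z))" "integrable (pair_pmf A B) (\<lambda>z. f' (snd z))"
    by simp_all
  then show "integrable (pair_pmf A B) (\<lambda>z. f (fst z) + f' (snd z))"
    by (rule Bochner_Integration.integrable_add)
  show "measure_pmf.expectation (pair_pmf A B) (\<lambda>z. f (fst z) + f' (snd z))
      = measure_pmf.expectation A f + measure_pmf.expectation B f'"
    using i by (simp add: Bochner_Integration.integral_add)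
qed

section \<open>Displacement of a random walk\<close>

locale isometric_walk =
  fixes p :: "'a::metric_space" and G :: "('a \<Rightarrow> 'a) set" and \<nu> :: "('a \<Rightarrow> 'a) pmf"
  assumes sub: "subgroup G isometry_group" and support: "set_pmf \<nu> \<subseteq> G"
    and moment: "integrable \<nu> (\<lambda>g. dist p (g p))"
begin

abbreviation walk :: "nat \<Rightarrow> ('a \<Rightarrow> 'a) pmf"
  where "walk \<equiv> convolution_power \<nu>"

definition displacement :: "nat \<Rightarrow> 'a \<Rightarrow> real"
  where "displacement n x = measure_pmf.expectation (walk n) (\<lambda>g. dist p (g x))"

lemma G_dist: "g \<in> G \<Longrightarrow> dist (g x) (g y) = dist x y"
  using subgroup.subset[OF sub] by (auto simp: isometry_group_def)

lemma G_surj: "g \<in> G \<Longrightarrow> surj g"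
  using subgroup.subset[OF sub] by (auto simp: isometry_group_def)

lemma G_comp: "g \<in> G \<Longrightarrow> h \<in> G \<Longrightarrow> g \<circ> h \<in> G"
  using subgroup.m_closed[OF sub] by (simp add: isometry_group_def)

lemma walk_in_G: "set_pmf (walk n) \<subseteq> G"
proof (induction n)
  case 0
  then show ?case
    using subgroup.one_closed[OF sub] by (simp add: isometry_group_def)
next
  case (Suc n)
  then show ?case
    using support G_comp unfolding convolution_power_Suc set_pmf_convolution by auto
qed

lemma dist_comp_le: "g \<in> G \<Longrightarrow> dist p (g (h x)) \<le> dist p (g p) + dist p (h x)"
  using dist_triangle[of p "g (h x)" "g p"] G_dist[of g p "h x"] by simp

lemma integrable_walk_base: "integrable (walk n) (\<lambda>g. dist p (g p))"
proof (induction n)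
  case (Suc n)
  have "integrable (pair_pmf (walk n) \<nu>) (\<lambda>z. dist p ((fst z \<circ> snd z) p))"
  proof (rule integrable_bound_support[OF integrable_pair_fst_snd(1)[OF Suc moment]])
    fix z
    assume "z \<in> set_pmf (pair_pmf (walk n) \<nu>)"
    then have "fst z \<in> G"
      using walk_in_G[of n] by auto
    then show "\<bar>dist p ((fst z \<circ> snd z) p)\<bar> \<le> dist p (fst z p) + dist p (snd z p)"
      using dist_comp_le[of "fst z" "snd z" p] by simp
  qed
  then show ?case
    by (simp add: convolution_power_Suc convolution_def case_prod_beta)
qed (simp add: integrable_measure_pmf_finite)

lemma integrable_walk: "integrable (walk n) (\<lambda>g. dist p (g x))"
proof (rule integrable_bound_support)
  show "integrable (walk n) (\<lambda>g. dist p (g p) + dist p x)"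
    using integrable_walk_base by simp
  fix g
  assume "g \<in> set_pmf (walk n)"
  then show "\<bar>dist p (g x)\<bar> \<le> dist p (g p) + dist p x"
    using dist_comp_le[of g "\<lambda>x. x" x] walk_in_G by auto
qed

lemma integrable_walk_pair:
  "integrable (pair_pmf (walk m) (walk n)) (\<lambda>z. dist p ((fst z \<circ> snd z) x))"
  using integrable_walk[of "m + n" x]
  by (simp add: convolution_power_add convolution_def case_prod_beta)

text \<open>
  The \<open>n\<close> steps that are applied first are integrated last, so that bounds for \<open>displacement m\<close> that
  hold at all points can be inserted.
\<close>

lemma displacement_add:
  "integrable (walk n) (\<lambda>h. displacement m (h x))"
  "displacement (m + n) x = measure_pmf.expectation (walk n) (\<lambda>h. displacement m (h x))"
proof -
  have int: "integrable (pair_pmf (walk n) (walk m)) (\<lambda>z. dist p ((snd z \<circ> fst z) x))"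
    using integrable_walk_pair[of m n x] by (simp add: pair_commute_pmf[of "walk m"] case_prod_beta)
  have eq: "displacement (m + n) x
      = measure_pmf.expectation (pair_pmf (walk n) (walk m)) (\<lambda>z. dist p ((snd z \<circ> fst z) x))"
    unfolding displacement_def convolution_power_add convolution_def
    by (subst pair_commute_pmf) (simp add: case_prod_beta)
  note * = expectation_pair_pmf_nonneg[where f = "\<lambda>z. dist p ((snd z \<circ> fst z) x)", OF _ int]
  show "integrable (walk n) (\<lambda>h. displacement m (h x))"
    using *(1) integrable_walk by (simp add: displacement_def)
  show "displacement (m + n) x = measure_pmf.expectation (walk n) (\<lambda>h. displacement m (h x))"
    unfolding eq using *(2) integrable_walk by (simp add: displacement_def)
qed

lemma displacement_0: "displacement 0 x = dist p x"
  by (simp add: displacement_def)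

lemma displacement_nonneg: "0 \<le> displacement n x"
  by (simp add: displacement_def)

lemma displacement_subadditive: "displacement (m + n) p \<le> displacement m p + displacement n p"
proof -
  note i = integrable_pair_fst_snd[OF
      integrable_walk[where x = p and n = m] integrable_walk[where x = p and n = n]]
  have "displacement (m + n) p
      = measure_pmf.expectation (pair_pmf (walk m) (walk n)) (\<lambda>z. dist p ((fst z \<circ> snd z) p))"
    by (simp add: displacement_def convolution_power_add convolution_def case_prod_beta)
  also have "\<dots> \<le> measure_pmf.expectation (pair_pmf (walk m) (walk n))
      (\<lambda>z. dist p (fst z p) + dist p (snd z p))"
  proof (rule expectation_mono_support[OF integrable_walk_pair i(1)])
    fix z
    assume "z \<in> set_pmf (pair_pmf (walk m) (walk n))"
    then have "fst z \<in> G"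
      using walk_in_G[of m] by auto
    then show "dist p ((fst z \<circ> snd z) p) \<le> dist p (fst z p) + dist p (snd z p)"
      using dist_comp_le[of "fst z" "snd z" p] by simp
  qed
  also have "\<dots> = displacement m p + displacement n p"
    unfolding i(2) displacement_def ..
  finally show ?thesis .
qed

lemma rate_of_escape_lim: "(\<lambda>n. 1 / real n * displacement n p) \<longlonglongrightarrow> rate_of_escape p G \<nu>"
proof -
  have "rate_of_escape p G \<nu> = lim (\<lambda>n. 1 / real n * displacement n p)"
    unfolding rate_of_escape_def displacement_def
    using infsum_pmf_eq_expectation[OF walk_in_G] by simp
  moreover have "convergent (\<lambda>n. 1 / real n * displacement n p)"
    by (rule subadditive_convergent[OF displacement_subadditive displacement_nonneg])
  ultimately show ?thesis
    by (simp add: convergent_LIMSEQ_iff)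
qed

lemma integrable_step: "integrable \<nu> (\<lambda>s. displacement n (s x))"
  using displacement_add(1)[where n = "Suc 0"] by (simp add: convolution_power_1)

lemma displacement_Suc: "displacement (Suc n) x = measure_pmf.expectation \<nu> (\<lambda>s. displacement n (s x))"
  using displacement_add(2)[of n "Suc 0" x] by (simp add: convolution_power_1)

text \<open>
  If one step never loses more than \<open>A\<close> on average and gains \<open>B\<close> on the set \<open>S\<close>, and some
  \<open>h\<close> reached in \<open>m\<close> steps with probability \<open>q\<close> moves the complement of \<open>S\<close> into \<open>S\<close>, then
  every block of \<open>m + 1\<close> steps contains a gaining step with probability at least \<open>q\<close>.
\<close>

lemma rate_of_escape_ge:
  assumes loss: "\<And>x. dist p x - A \<le> displacement (Suc 0) x" and A: "0 \<le> A"
    and gain: "\<And>x. x \<in> S \<Longrightarrow> dist p x + B \<le> displacement (Suc 0) x" and B: "0 \<le> B"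
    and q: "0 \<le> q" "q \<le> 1" "q \<le> pmf (walk m) h"
    and h: "\<And>x. x \<in> S \<or> h x \<in> S"
  shows "(q * B - real (Suc m) * A) / real (Suc m) \<le> rate_of_escape p G \<nu>"
proof -
  define c where "c = q * B - real (Suc m) * A"
  have loss_n: "dist p x - real n * A \<le> displacement n x" for n x
  proof (induction n arbitrary: x)
    case (Suc n)
    have "dist p x - real (Suc n) * A \<le> displacement (Suc 0) x - real n * A"
      using loss[of x] by (simp add: algebra_simps)
    also have "\<dots> = measure_pmf.expectation \<nu> (\<lambda>s. displacement 0 (s x) - real n * A)"
      using integrable_step[of 0 x] by (simp add: displacement_Suc)
    also have "\<dots> \<le> measure_pmf.expectation \<nu> (\<lambda>s. displacement n (s x))"
    proof (rule expectation_mono_support[OF _ integrable_step])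
      show "integrable \<nu> (\<lambda>s. displacement 0 (s x) - real n * A)"
        by (intro Bochner_Integration.integrable_diff integrable_step) simp
      show "displacement 0 (s x) - real n * A \<le> displacement n (s x)" for s
        unfolding displacement_0 by (rule Suc)
    qed
    finally show ?case
      by (simp add: displacement_Suc)
  qed (simp add: displacement_0)
  \<comment> \<open>If \<open>x \<in> S\<close>, the first step of the block gains; otherwise the last one does, on the event that the
    first \<open>m\<close> steps compose to \<open>h\<close>.\<close>
  have block: "dist p x + c \<le> displacement (Suc m) x" for x
  proof (cases "x \<in> S")
    case True
    have "q * B \<le> B"
      using q B by (simp add: mult_left_le_one_le)
    then have "dist p x + c \<le> displacement (Suc 0) x - real m * A"
      using gain[OF True] A by (simp add: c_def algebra_simps)
    also have "\<dots> = measure_pmf.expectation \<nu> (\<lambda>s. displacement 0 (s x) - real m * A)"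
      using integrable_step[of 0 x] by (simp add: displacement_Suc)
    also have "\<dots> \<le> measure_pmf.expectation \<nu> (\<lambda>s. displacement m (s x))"
    proof (rule expectation_mono_support[OF _ integrable_step])
      show "integrable \<nu> (\<lambda>s. displacement 0 (s x) - real m * A)"
        by (intro Bochner_Integration.integrable_diff integrable_step) simp
      show "displacement 0 (s x) - real m * A \<le> displacement m (s x)" for s
        unfolding displacement_0 by (rule loss_n)
    qed
    finally show ?thesis
      by (simp add: displacement_Suc)
  next
    case False
    then have hx: "h x \<in> S"
      using h by blast
    have ind: "integrable (walk m) (\<lambda>g. indicator {h} g * (A + B))"
      by (rule integrable_bound_support[where g = "\<lambda>_. A + B"]) (use A B in \<open>auto split: split_indicator\<close>)
    have "q * (A + B) \<le> pmf (walk m) h * (A + B)"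
      using q A B by (intro mult_right_mono) auto
    moreover have "0 \<le> q * A"
      using q A by simp
    ultimately have "dist p x + c \<le> displacement m x - A + pmf (walk m) h * (A + B)"
      using loss_n[of x m] unfolding c_def by (simp add: algebra_simps)
    also have "\<dots> = measure_pmf.expectation (walk m) (\<lambda>g. dist p (g x) - A + indicator {h} g * (A + B))"
      using ind integrable_walk[of m x] by (simp add: displacement_def measure_pmf_single)
    also have "\<dots> \<le> measure_pmf.expectation (walk m) (\<lambda>g. displacement (Suc 0) (g x))"
      using ind integrable_walk displacement_add(1) loss gain[OF hx]
      by (intro expectation_mono_support) (auto split: split_indicator)
    also have "\<dots> = displacement (Suc m) x"
      using displacement_add(2)[of "Suc 0" m x] by simp
    finally show ?thesis .
  qed
  have blocks: "real j * c \<le> displacement (j * Suc m) p" for j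
  proof (induction j)
    case (Suc j)
    have "real (Suc j) * c \<le> displacement (j * Suc m) p + c"
      using Suc by (simp add: algebra_simps)
    also have "\<dots> = measure_pmf.expectation (walk (j * Suc m)) (\<lambda>g. dist p (g p) + c)"
      using integrable_walk by (simp add: displacement_def)
    also have "\<dots> \<le> measure_pmf.expectation (walk (j * Suc m)) (\<lambda>g. displacement (Suc m) (g p))"
      using integrable_walk displacement_add(1) block by (intro expectation_mono_support) auto
    also have "\<dots> = displacement (Suc j * Suc m) p"
      using displacement_add(2)[of "Suc m" "j * Suc m" p] by (simp only: mult_Suc)
    finally show ?case .
  qed (simp add: displacement_nonneg)
  have "strict_mono (\<lambda>j. Suc j * Suc m)"
    by (rule strict_monoI) (simp del: mult_Suc mult_Suc_right)
  from LIMSEQ_subseq_LIMSEQ[OF rate_of_escape_lim this]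
  have "(\<lambda>j. 1 / real (Suc j * Suc m) * displacement (Suc j * Suc m) p) \<longlonglongrightarrow> rate_of_escape p G \<nu>"
    by (simp add: o_def)
  moreover have "c / real (Suc m) \<le> 1 / real (Suc j * Suc m) * displacement (Suc j * Suc m) p" for j
  proof -
    have "c / real (Suc m) = 1 / real (Suc j * Suc m) * (real (Suc j) * c)"
      unfolding of_nat_mult by (simp del: of_nat_Suc)
    also have "\<dots> \<le> 1 / real (Suc j * Suc m) * displacement (Suc j * Suc m) p"
      by (rule mult_left_mono[OF blocks]) simp
    finally show ?thesis .
  qed
  ultimately show ?thesis
    unfolding c_def by (intro LIMSEQ_le_const) auto
qed

end

section \<open>Entropy\<close>

lemma shannon_entropy_eq_expectation:
  assumes "set_pmf \<nu> \<subseteq> G"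
  shows "shannon_entropy G \<nu> = measure_pmf.expectation \<nu> (\<lambda>g. - ln (pmf \<nu> g))"
  unfolding shannon_entropy_def by (simp add: infsum_pmf_eq_expectation[OF assms])

abbreviation finite_entropy :: "('b \<Rightarrow> 'b) pmf \<Rightarrow> bool"
  where "finite_entropy \<nu> \<equiv> integrable (measure_pmf \<nu>) (\<lambda>g. - ln (pmf \<nu> g))"

lemma neg_ln_pmf_nonneg: "0 \<le> - ln (pmf \<nu> g)"
  using pmf_le_1[of \<nu> g] pmf_nonneg[of \<nu> g] by (cases "pmf \<nu> g = 0") auto

lemma shannon_entropy_nonneg: "set_pmf \<nu> \<subseteq> G \<Longrightarrow> 0 \<le> shannon_entropy G \<nu>"
  unfolding shannon_entropy_eq_expectation by (intro Bochner_Integration.integral_nonneg neg_ln_pmf_nonneg)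

text \<open>
  Every atom of the convolution is at least the product of any two atoms that compose to it; taking
  logarithms and integrating over the pair gives subadditivity.
\<close>

lemma entropy_convolution:
  assumes fin: "finite_entropy \<nu>" "finite_entropy \<nu>'"
  shows "finite_entropy (convolution \<nu> \<nu>')"
    and "measure_pmf.expectation (convolution \<nu> \<nu>') (\<lambda>g. - ln (pmf (convolution \<nu> \<nu>') g))
      \<le> measure_pmf.expectation \<nu> (\<lambda>g. - ln (pmf \<nu> g))
        + measure_pmf.expectation \<nu>' (\<lambda>g. - ln (pmf \<nu>' g))"
proof -
  let ?c = "convolution \<nu> \<nu>'"
  let ?s = "\<lambda>z. - ln (pmf \<nu> (fst z)) + - ln (pmf \<nu>' (snd z))"
  note i = integrable_pair_fst_snd[OF fin]
  have le: "- ln (pmf ?c (fst z \<circ> snd z)) \<le> ?s z" if "z \<in> set_pmf (pair_pmf \<nu> \<nu>')" for z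
  proof -
    have pos: "0 < pmf \<nu> (fst z)" "0 < pmf \<nu>' (snd z)"
      using that by (auto simp: pmf_positive)
    then have "ln (pmf \<nu> (fst z) * pmf \<nu>' (snd z)) \<le> ln (pmf ?c (fst z \<circ> snd z))"
      using pmf_convolution_ge[of \<nu> "fst z" \<nu>' "snd z"]
      by (meson ln_mono mult_pos_pos order_less_le_trans)
    then show ?thesis
      using pos by (simp add: ln_mult)
  qed
  have int: "integrable (pair_pmf \<nu> \<nu>') (\<lambda>z. - ln (pmf ?c (fst z \<circ> snd z)))"
  proof (rule integrable_bound_support[OF i(1)])
    fix z
    assume "z \<in> set_pmf (pair_pmf \<nu> \<nu>')"
    then show "\<bar>- ln (pmf ?c (fst z \<circ> snd z))\<bar> \<le> ?s z"
      using le[of z] neg_ln_pmf_nonneg[of ?c "fst z \<circ> snd z"] by linarith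
  qed
  have map: "?c = map_pmf (\<lambda>z. fst z \<circ> snd z) (pair_pmf \<nu> \<nu>')"
    by (simp add: convolution_def case_prod_unfold)
  have "integrable (map_pmf (\<lambda>z. fst z \<circ> snd z) (pair_pmf \<nu> \<nu>')) (\<lambda>g. - ln (pmf ?c g))"
    using int by simp
  then show "finite_entropy ?c"
    by (simp only: map[symmetric])
  have "measure_pmf.expectation ?c (\<lambda>g. - ln (pmf ?c g))
      = measure_pmf.expectation (map_pmf (\<lambda>z. fst z \<circ> snd z) (pair_pmf \<nu> \<nu>')) (\<lambda>g. - ln (pmf ?c g))"
    by (simp only: map[symmetric])
  also have "\<dots> = measure_pmf.expectation (pair_pmf \<nu> \<nu>') (\<lambda>z. - ln (pmf ?c (fst z \<circ> snd z)))"
    by (rule integral_map_pmf)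
  also have "\<dots> \<le> measure_pmf.expectation (pair_pmf \<nu> \<nu>') ?s"
    by (rule expectation_mono_support[OF int i(1) le])
  also have "\<dots> = measure_pmf.expectation \<nu> (\<lambda>g. - ln (pmf \<nu> g))
      + measure_pmf.expectation \<nu>' (\<lambda>g. - ln (pmf \<nu>' g))"
    by (rule i(2))
  finally show "measure_pmf.expectation ?c (\<lambda>g. - ln (pmf ?c g))
      \<le> measure_pmf.expectation \<nu> (\<lambda>g. - ln (pmf \<nu> g))
        + measure_pmf.expectation \<nu>' (\<lambda>g. - ln (pmf \<nu>' g))" .
qed

text \<open>
  The function \<open>t - t ln t\<close> is increasing on the whole unit interval, unlike \<open>- t ln t\<close>; the
  extra linear term is harmless for probability measures.
\<close>

lemma minus_t_ln_t_le:
  fixes s t :: real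
  assumes "0 < s" "s \<le> t" "t \<le> 1"
  shows "- s * ln s \<le> t - t * ln t"
proof -
  have "s - s * ln s \<le> t - t * ln t"
  proof (rule DERIV_nonneg_imp_nondecreasing[OF assms(2)])
    fix x
    assume "s \<le> x" "x \<le> t"
    then have "((\<lambda>x. x - x * ln x) has_real_derivative - ln x) (at x)" "0 \<le> - ln x"
      using assms by (auto intro!: derivative_eq_intros)
    then show "\<exists>y. ((\<lambda>x. x - x * ln x) has_real_derivative y) (at x) \<and> 0 \<le> y"
      by blast
  qed
  then show ?thesis
    using assms by simp
qed

text \<open>
  Finiteness of entropy passes to a distribution whose atoms are dominated, up to a factor, by
  distinct atoms of another.  It is used to descend from a convolution to its first factor and from
  the mixture to \<open>\<mu>\<close>.
\<close>

lemma finite_entropy_transfer: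
  assumes T: "inj T" and c: "0 < c" and dom: "\<And>g. c * pmf \<nu> g \<le> pmf \<nu>' (T g)"
    and fin: "finite_entropy \<nu>'"
  shows "finite_entropy \<nu>"
proof -
  have "(\<lambda>g. pmf \<nu>' g * (1 - ln (pmf \<nu>' g))) summable_on UNIV"
    using fin by (simp add: integrable_pmf_iff_summable[symmetric])
  then have "(\<lambda>g. pmf \<nu>' g * (1 - ln (pmf \<nu>' g))) summable_on range T"
    by (rule summable_on_subset) auto
  then have "(\<lambda>g. pmf \<nu>' (T g) * (1 - ln (pmf \<nu>' (T g)))) summable_on UNIV"
    using summable_on_reindex[OF T, of "\<lambda>g. pmf \<nu>' g * (1 - ln (pmf \<nu>' g))"] by (simp add: o_def)
  then have sum: "(\<lambda>g. inverse c * (pmf \<nu>' (T g) * (1 - ln (pmf \<nu>' (T g))))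
      + pmf \<nu> g * ln c) summable_on UNIV"
    using integrable_pmf_iff_summable[of \<nu> "\<lambda>_. ln c"]
    by (intro summable_on_add summable_on_cmult_right) auto
  have "pmf \<nu> g * - ln (pmf \<nu> g)
      \<le> inverse c * (pmf \<nu>' (T g) * (1 - ln (pmf \<nu>' (T g)))) + pmf \<nu> g * ln c" for g
  proof (cases "pmf \<nu> g = 0")
    case True
    have "0 \<le> pmf \<nu>' (T g) * (1 - ln (pmf \<nu>' (T g)))"
      using neg_ln_pmf_nonneg[of \<nu>' "T g"] by (intro mult_nonneg_nonneg) (auto simp: pmf_nonneg)
    then show ?thesis
      using True c by simp
  next
    case False
    then have pos: "0 < pmf \<nu> g"
      by (simp add: pmf_positive set_pmf_iff)
    have "- (c * pmf \<nu> g) * ln (c * pmf \<nu> g) \<le> pmf \<nu>' (T g) - pmf \<nu>' (T g) * ln (pmf \<nu>' (T g))"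
      using pos c dom by (intro minus_t_ln_t_le) (auto simp: pmf_le_1)
    then have "c * (pmf \<nu> g * - ln (pmf \<nu> g)) \<le> pmf \<nu>' (T g) * (1 - ln (pmf \<nu>' (T g)))
        + c * (pmf \<nu> g * ln c)"
      using pos c by (simp add: ln_mult algebra_simps)
    then show ?thesis
      using c by (simp add: field_simps)
  qed
  then have "(\<lambda>g. pmf \<nu> g * - ln (pmf \<nu> g)) summable_on UNIV"
    using summable_on_comparison_test[OF sum] pmf_nonneg neg_ln_pmf_nonneg
    by (metis (no_types, lifting) mult_nonneg_nonneg)
  then show ?thesis
    unfolding integrable_pmf_iff_summable .
qed

text \<open>
  A step distribution of infinite entropy makes all later entropies infinite, that is 0 by
  convention.  Otherwise subadditivity yields the limit and its bound.
\<close>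

lemma (in isometric_walk) asymptotic_entropy_bounds:
  "0 \<le> asymptotic_entropy G \<nu>" "asymptotic_entropy G \<nu> \<le> shannon_entropy G \<nu>"
proof -
  let ?H = "\<lambda>n. shannon_entropy G (walk n)"
  have H_nonneg: "0 \<le> ?H n" for n
    by (rule shannon_entropy_nonneg[OF walk_in_G])
  have "\<exists>L. (\<lambda>n. 1 / real n * ?H n) \<longlonglongrightarrow> L \<and> L \<le> shannon_entropy G \<nu>"
  proof (cases "finite_entropy \<nu>")
    case True
    have fin: "finite_entropy (walk n)" for n
    proof (induction n)
      case (Suc n)
      then show ?case
        unfolding convolution_power_Suc using True by (rule entropy_convolution(1))
    qed (simp add: integrable_measure_pmf_finite)
    have sub: "?H (m + n) \<le> ?H m + ?H n" for m n
      unfolding shannon_entropy_eq_expectation[OF walk_in_G]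
      unfolding convolution_power_add by (rule entropy_convolution(2)[OF fin fin])
    have "?H n \<le> real n * shannon_entropy G \<nu>" for n
    proof (induction n)
      case 0
      show ?case
        by (simp add: shannon_entropy_eq_expectation[OF walk_in_G, of 0, simplified])
    next
      case (Suc n)
      then show ?case
        using sub[of n "Suc 0"] by (simp add: convolution_power_1 algebra_simps)
    qed
    then have "1 / real n * ?H n \<le> shannon_entropy G \<nu>" if "1 \<le> n" for n
      using that by (simp add: field_simps)
    moreover obtain L where "(\<lambda>n. 1 / real n * ?H n) \<longlonglongrightarrow> L"
      using subadditive_convergent[of ?H, OF sub H_nonneg] by (auto simp: convergent_def)
    ultimately show ?thesis
      by (meson LIMSEQ_le_const2)
  next
    case False
    have "?H n = 0" if n: "1 \<le> n" for n
    proof -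
      obtain l where l: "n = Suc l"
        using n by (cases n) auto
      obtain h where h: "h \<in> set_pmf (walk l)"
        using set_pmf_not_empty by fast
      have "surj h"
        using G_surj h walk_in_G by blast
      then have "inj (\<lambda>g. g \<circ> h)"
        by (intro injI) (metis comp_apply ext surjD)
      moreover have "pmf (walk l) h * pmf \<nu> g \<le> pmf (walk n) (g \<circ> h)" for g
        using pmf_convolution_ge[of \<nu> g "walk l" h] convolution_power_add[of \<nu> "Suc 0" l]
        by (simp add: l convolution_power_1 mult.commute)
      ultimately have "\<not> finite_entropy (walk n)"
        using False finite_entropy_transfer[of "\<lambda>g. g \<circ> h" "pmf (walk l) h" \<nu> "walk n"] h
        by (auto simp: pmf_positive)
      then show ?thesis
        unfolding shannon_entropy_eq_expectation[OF walk_in_G]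
        by (rule not_integrable_integral_eq)
    qed
    then have "eventually (\<lambda>n. 1 / real n * ?H n = 0) sequentially"
      by (intro eventually_sequentiallyI[of 1]) simp
    then have "(\<lambda>n. 1 / real n * ?H n) \<longlonglongrightarrow> 0"
      by (rule tendsto_eventually)
    then show ?thesis
      using shannon_entropy_nonneg[OF support] by blast
  qed
  then obtain L where L: "(\<lambda>n. 1 / real n * ?H n) \<longlonglongrightarrow> L" "L \<le> shannon_entropy G \<nu>"
    by blast
  have "asymptotic_entropy G \<nu> = L"
    unfolding asymptotic_entropy_def using L(1) by (rule limI)
  moreover have "0 \<le> L"
    using L(1) by (rule LIMSEQ_le_const) (auto intro!: exI[of _ 0] simp: H_nonneg)
  ultimately show "0 \<le> asymptotic_entropy G \<nu>" "asymptotic_entropy G \<nu> \<le> shannon_entropy G \<nu>"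
    using L(2) by simp_all
qed

section \<open>The mixture with powers of the hyperbolic element\<close>

lemma set_pmf_mixed_measure_subset:
  "set_pmf (mixed_measure \<mu> \<gamma> k) \<subseteq> set_pmf \<mu> \<union>
    {\<gamma> [^]\<^bsub>isometry_group\<^esub> int k, \<gamma> [^]\<^bsub>isometry_group\<^esub> (- int k)}"
  by (auto simp: set_pmf_iff pmf_mixed_measure indicator_def split: if_splits)

lemma expectation_mixed_measure:
  fixes \<mu> :: "('a::metric_space \<Rightarrow> 'a) pmf" and f :: "('a \<Rightarrow> 'a) \<Rightarrow> real"
    and \<gamma> :: "'a \<Rightarrow> 'a" and k :: nat
  assumes f: "integrable \<mu> f"
  defines "a \<equiv> \<gamma> [^]\<^bsub>isometry_group\<^esub> int k" and "b \<equiv> \<gamma> [^]\<^bsub>isometry_group\<^esub> (- int k)"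
  shows "integrable (mixed_measure \<mu> \<gamma> k) f"
    and "measure_pmf.expectation (mixed_measure \<mu> \<gamma> k) f
      = 1/2 * measure_pmf.expectation \<mu> f + 1/4 * (f a + f b)"
proof -
  have eq: "pmf (mixed_measure \<mu> \<gamma> k) g * f g = 1/2 * (pmf \<mu> g * f g)
      + 1/4 * (pmf (return_pmf a) g * f g + pmf (return_pmf b) g * f g)" for g
    by (simp add: pmf_mixed_measure a_def b_def algebra_simps)
  have ret: "(\<lambda>g. pmf (return_pmf h) g * f g) summable_on UNIV" for h
    by (rule integrable_pmf_iff_summable[THEN iffD1]) (simp add: integrable_measure_pmf_finite)
  have \<mu>: "(\<lambda>g. pmf \<mu> g * f g) summable_on UNIV"
    using f by (simp add: integrable_pmf_iff_summable)
  show "integrable (mixed_measure \<mu> \<gamma> k) f"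
    unfolding integrable_pmf_iff_summable eq
    by (intro summable_on_add summable_on_cmult_right \<mu> ret)
  have "measure_pmf.expectation (mixed_measure \<mu> \<gamma> k) f
      = (\<Sum>\<^sub>\<infinity>g. pmf (mixed_measure \<mu> \<gamma> k) g * f g)"
    by (rule infsum_pmf_eq_expectation[symmetric]) simp
  also have "\<dots> = 1/2 * (\<Sum>\<^sub>\<infinity>g. pmf \<mu> g * f g)
      + 1/4 * ((\<Sum>\<^sub>\<infinity>g. pmf (return_pmf a) g * f g) + (\<Sum>\<^sub>\<infinity>g. pmf (return_pmf b) g * f g))"
    unfolding eq infsum_add[OF summable_on_cmult_right[OF \<mu>]
        summable_on_cmult_right[OF summable_on_add[OF ret ret]]]
    by (simp only: infsum_cmult_right' infsum_add[OF ret ret])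
  also have "\<dots> = 1/2 * measure_pmf.expectation \<mu> f + 1/4 * (f a + f b)"
    unfolding infsum_pmf_eq_expectation[OF subset_UNIV] by simp
  finally show "measure_pmf.expectation (mixed_measure \<mu> \<gamma> k) f
      = 1/2 * measure_pmf.expectation \<mu> f + 1/4 * (f a + f b)" .
qed

text \<open>
  Every atom of the mixture has at least its weight from one of the three parts, which bounds the
  entropy by the entropy of \<open>\<mu>\<close> plus that of the choice of the part, whatever \<open>k\<close> is.
\<close>

lemma shannon_entropy_mixed_measure_le:
  assumes supp: "set_pmf (mixed_measure \<mu> \<gamma> k) \<subseteq> G" and \<mu>: "set_pmf \<mu> \<subseteq> G"
  shows "shannon_entropy G (mixed_measure \<mu> \<gamma> k) \<le> (shannon_entropy G \<mu> + ln 2 + ln 4) / 2"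
proof (cases "finite_entropy (mixed_measure \<mu> \<gamma> k)")
  case False
  then have "shannon_entropy G (mixed_measure \<mu> \<gamma> k) = 0"
    unfolding shannon_entropy_eq_expectation[OF supp] by (rule not_integrable_integral_eq)
  then show ?thesis
    using shannon_entropy_nonneg[OF \<mu>] by simp
next
  case True
  let ?m = "mixed_measure \<mu> \<gamma> k"
  define a where "a = \<gamma> [^]\<^bsub>isometry_group\<^esub> int k"
  define b where "b = \<gamma> [^]\<^bsub>isometry_group\<^esub> (- int k)"
  have half: "1/2 * pmf \<mu> g \<le> pmf ?m g" for g
    by (simp add: pmf_mixed_measure)
  have fin: "finite_entropy \<mu>"
    by (rule finite_entropy_transfer[OF inj_on_id, of "1/2" _ ?m]) (use half True in auto)
  have le: "- ln (pmf ?m g) \<le> ln 2 + - ln (pmf \<mu> g)" if "g \<in> set_pmf \<mu>" for g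
  proof -
    have pos: "0 < pmf \<mu> g"
      using that by (simp add: pmf_positive)
    then have "ln (1/2 * pmf \<mu> g) \<le> ln (pmf ?m g)"
      using half[of g] by (intro ln_mono) auto
    then show ?thesis
      using pos by (simp add: ln_mult ln_div)
  qed
  have int: "integrable \<mu> (\<lambda>g. - ln (pmf ?m g))"
  proof (rule integrable_bound_support)
    show "integrable \<mu> (\<lambda>g. ln 2 + - ln (pmf \<mu> g))"
      using fin by simp
    show "\<bar>- ln (pmf ?m g)\<bar> \<le> ln 2 + - ln (pmf \<mu> g)" if "g \<in> set_pmf \<mu>" for g
      using le[OF that] neg_ln_pmf_nonneg[of ?m g] by linarith
  qed
  have "1/4 \<le> pmf ?m c" if "pmf (return_pmf a) c = 1 \<or> pmf (return_pmf b) c = 1" for c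
    using that pmf_mixed_measure[of \<mu> \<gamma> k c, folded a_def b_def] pmf_nonneg[of \<mu> c]
      pmf_nonneg[of "return_pmf a" c] pmf_nonneg[of "return_pmf b" c]
    unfolding distrib_left by linarith
  from this[of a] this[of b] have "1/4 \<le> pmf ?m a" "1/4 \<le> pmf ?m b"
    by simp_all
  then have "ln (1/4) \<le> ln (pmf ?m a)" "ln (1/4) \<le> ln (pmf ?m b)"
    by (intro ln_mono; simp)+
  then have ab: "- ln (pmf ?m a) \<le> ln 4" "- ln (pmf ?m b) \<le> ln 4"
    by (simp_all add: ln_div)
  have "shannon_entropy G ?m = 1/2 * measure_pmf.expectation \<mu> (\<lambda>g. - ln (pmf ?m g))
      + 1/4 * (- ln (pmf ?m a) + - ln (pmf ?m b))"
    unfolding shannon_entropy_eq_expectation[OF supp] a_def b_def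
    by (rule expectation_mixed_measure(2)[OF int])
  also have "\<dots> \<le> 1/2 * measure_pmf.expectation \<mu> (\<lambda>g. ln 2 + - ln (pmf \<mu> g)) + 1/4 * (ln 4 + ln 4)"
    using int fin le ab by (intro add_mono mult_left_mono expectation_mono_support) auto
  also have "measure_pmf.expectation \<mu> (\<lambda>g. ln 2 + - ln (pmf \<mu> g)) = ln 2 + shannon_entropy G \<mu>"
    using fin by (simp add: shannon_entropy_eq_expectation[OF \<mu>])
  finally show ?thesis
    by (simp add: field_simps)
qed

text \<open>
  A fixed element of \<open>G\<close> is a product of elements of the support of \<open>\<mu>\<close>, each of which the
  mixture chooses with at least half of its old probability.
\<close>

lemma reached_uniformly:
  assumes "h \<in> semigroup_generated (set_pmf \<mu>)"
  shows "\<exists>m q. 0 < q \<and> (\<forall>k. q \<le> pmf (convolution_power (mixed_measure \<mu> \<gamma> k) m) h)"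
proof -
  define S where "S = {h. \<exists>m q. 0 < q \<and> (\<forall>k. q \<le> pmf (convolution_power (mixed_measure \<mu> \<gamma> k) m) h)}"
  have "set_pmf \<mu> \<subseteq> S"
  proof
    fix g
    assume "g \<in> set_pmf \<mu>"
    then have "0 < 1/2 * pmf \<mu> g"
      by (simp add: pmf_positive)
    moreover have "1/2 * pmf \<mu> g \<le> pmf (convolution_power (mixed_measure \<mu> \<gamma> k) (Suc 0)) g" for k
      by (simp add: convolution_power_1 pmf_mixed_measure)
    ultimately show "g \<in> S"
      unfolding S_def by blast
  qed
  moreover have "g \<circ> h \<in> S" if "g \<in> S" "h \<in> S" for g h
  proof -
    obtain m q where mq: "0 < q" "\<And>k. q \<le> pmf (convolution_power (mixed_measure \<mu> \<gamma> k) m) g"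
      using \<open>g \<in> S\<close> by (auto simp: S_def)
    obtain n r where nr: "0 < r" "\<And>k. r \<le> pmf (convolution_power (mixed_measure \<mu> \<gamma> k) n) h"
      using \<open>h \<in> S\<close> by (auto simp: S_def)
    have "q * r \<le> pmf (convolution_power (mixed_measure \<mu> \<gamma> k) (m + n)) (g \<circ> h)" for k
    proof -
      have "q * r \<le> pmf (convolution_power (mixed_measure \<mu> \<gamma> k) m) g
          * pmf (convolution_power (mixed_measure \<mu> \<gamma> k) n) h"
        using mq nr by (intro mult_mono) auto
      also have "\<dots> \<le> pmf (convolution_power (mixed_measure \<mu> \<gamma> k) (m + n)) (g \<circ> h)"
        unfolding convolution_power_add by (rule pmf_convolution_ge)
      finally show ?thesis .
    qed
    then show ?thesis
      using mq(1) nr(1) unfolding S_def by (auto intro!: exI[of _ "m + n"] exI[of _ "q * r"])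
  qed
  ultimately have "semigroup_generated (set_pmf \<mu>) \<subseteq> S"
    unfolding semigroup_generated_def by (intro hull_minimal) auto
  with assms show ?thesis
    by (auto simp: S_def)
qed

section \<open>Entropy against rate of escape\<close>

theorem proposition4p5:
  fixes p :: "'a::metric_space" and \<delta> :: real
    and G :: "('a \<Rightarrow> 'a) set" and \<mu> :: "('a \<Rightarrow> 'a) pmf" and \<gamma>\<^sub>0 :: "'a \<Rightarrow> 'a"
  assumes "hyperbolic_space \<delta> TYPE('a)"
    and "subgroup G isometry_group"
    and "properly_discontinuous G"
    and "non_elementary p G"
    and "set_pmf \<mu> \<subseteq> G"
    and "finite_first_moment p G \<mu>"
    and "semigroup_generated (set_pmf \<mu>) = G"
    and "\<gamma>\<^sub>0 \<in> G"
    and "hyperbolic_isometry p \<gamma>\<^sub>0"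
  shows "(\<lambda>k. asymptotic_entropy G (mixed_measure \<mu> \<gamma>\<^sub>0 k) /
              rate_of_escape p G (mixed_measure \<mu> \<gamma>\<^sub>0 k)) \<longlonglongrightarrow> 0"
proof -
  define T where "T i = \<gamma>\<^sub>0 [^]\<^bsub>isometry_group\<^esub> i" for i :: int
  have hyp: "gromov_hyperbolic \<delta> TYPE('a)" and proper: "proper_space TYPE('a)"
    using assms(1) by (auto intro: hyperbolic_space_gromov_hyperbolic simp: hyperbolic_space_def)
  obtain C where "loxodromic p \<delta> C T"
    using loxodromic_powers[OF hyp assms(9)] unfolding T_def by blast
  then interpret loxodromic p \<delta> C T .
  have TG: "T i \<in> G" for i
    using group.int_pow_closed[OF subgroup.subgroup_is_group[OF assms(2) group_isometry_group], of \<gamma>\<^sub>0 i]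
      group.int_pow_consistent[OF group_isometry_group assms(2,8), of i] assms(8)
    by (simp add: T_def)
  obtain h where h: "h \<in> G" "\<And>j. axis_width < dist (h p) (T j p)"
    using elementary_if_orbit_near_axis[of G axis_width] assms(4) by (meson not_le)
  obtain R0 where R0: "\<And>i j. gromov_product p (h (T i p)) (T j p) \<le> R0"
    using bounded_product_if_off_axis[OF proper assms(2,3) TG h] by blast
  have h_dist: "dist (h x) (h y) = dist x y" for x y
    using subgroup.subset[OF assms(2)] h(1) by (auto simp: isometry_group_def)
  define R where "R = R0 + \<delta> + dist p (h p)"
  define S where "S = away_from_ends R"
  have S: "x \<in> S \<or> h x \<in> S" for x
    unfolding S_def R_def by (rule away_from_ends_or_moved_away[OF h_dist R0])
  obtain m q where q: "0 < q" "\<And>k. q \<le> pmf (convolution_power (mixed_measure \<mu> \<gamma>\<^sub>0 k) m) h"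
    using reached_uniformly[of h \<mu> \<gamma>\<^sub>0] h(1) assms(7) by auto
  have q1: "q \<le> 1"
    by (rule order_trans[OF q(2)[of 0] pmf_le_1])
  have \<mu>_moment: "integrable \<mu> (\<lambda>g. dist p (g p))"
    using assms(6) summable_on_support[OF assms(5)] by (simp add: finite_first_moment_def)
  interpret \<mu>: isometric_walk p G \<mu>
    by (rule isometric_walk.intro[OF assms(2,5) \<mu>_moment])
  define E where "E = measure_pmf.expectation \<mu> (\<lambda>g. dist p (g p))"
  have walk: "isometric_walk p G (mixed_measure \<mu> \<gamma>\<^sub>0 k)" for k
  proof (rule isometric_walk.intro[OF assms(2) _ expectation_mixed_measure(1)[OF \<mu>_moment]])
    show "set_pmf (mixed_measure \<mu> \<gamma>\<^sub>0 k) \<subseteq> G"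
      using set_pmf_mixed_measure_subset[of \<mu> \<gamma>\<^sub>0 k] assms(5) TG[of "int k"] TG[of "- int k"]
      unfolding T_def by blast
  qed
  have \<mu>_int: "integrable \<mu> (\<lambda>g. dist p (g x))" for x
    using \<mu>.integrable_walk[of "Suc 0" x] by (simp add: convolution_power_1)
  have \<mu>_loss: "dist p x - E \<le> measure_pmf.expectation \<mu> (\<lambda>g. dist p (g x))" for x
  proof -
    have "dist p x - E = measure_pmf.expectation \<mu> (\<lambda>g. dist p x - dist p (g p))"
      using \<mu>_moment by (simp add: E_def)
    also have "\<dots> \<le> measure_pmf.expectation \<mu> (\<lambda>g. dist p (g x))"
    proof (rule expectation_mono_support)
      fix g
      assume "g \<in> set_pmf \<mu>"
      then have "dist (g p) (g x) = dist p x"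
        using \<mu>.G_dist assms(5) by blast
      then show "dist p x - dist p (g p) \<le> dist p (g x)"
        using dist_triangle3[of "g p" "g x" p] by simp
    qed (use \<mu>_moment \<mu>_int in auto)
    finally show ?thesis .
  qed
  have step: "isometric_walk.displacement p (mixed_measure \<mu> \<gamma>\<^sub>0 k) (Suc 0) x
      = 1/2 * measure_pmf.expectation \<mu> (\<lambda>g. dist p (g x))
        + 1/4 * (dist p (T (int k) x) + dist p (T (- int k) x))" for k x
    unfolding isometric_walk.displacement_def[OF walk] convolution_power_1 T_def
    by (rule expectation_mixed_measure(2)[OF \<mu>_int])
  \<comment> \<open>Loss and gain of one step: weight one half is on \<open>\<mu>\<close>, one quarter on each translation.\<close>
  define A where "A = E / 2 + (C + \<delta>) / 2"
  define B where "B k = dist p (T (int k) p) / 2 - R - E / 2" for k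
  have A0: "0 \<le> A"
    using C_nonneg delta_nonneg by (simp add: A_def E_def)
  have rate: "(q * B k - real (Suc m) * A) / real (Suc m) \<le> rate_of_escape p G (mixed_measure \<mu> \<gamma>\<^sub>0 k)"
    if "0 \<le> B k" for k
  proof (rule isometric_walk.rate_of_escape_ge[OF walk _ A0 _ that _ q1 q(2) S])
    fix x
    show "dist p x - A \<le> isometric_walk.displacement p (mixed_measure \<mu> \<gamma>\<^sub>0 k) (Suc 0) x"
      using \<mu>_loss[of x] translation_no_loss[of "int k" x] unfolding step A_def
      by (simp add: field_simps)
    assume "x \<in> S"
    then show "dist p x + B k \<le> isometric_walk.displacement p (mixed_measure \<mu> \<gamma>\<^sub>0 k) (Suc 0) x"
      using \<mu>_loss[of x] translation_gain[of x R "int k"] unfolding step B_def S_def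
      by (simp add: field_simps)
  qed (use q in auto)
  have "filterlim (\<lambda>k. rate_of_escape p G (mixed_measure \<mu> \<gamma>\<^sub>0 k)) at_top sequentially"
    unfolding filterlim_at_top
  proof
    fix Z
    \<comment> \<open>With \<open>B k \<ge> M\<close> the lower bound \<open>rate\<close> is at least \<open>Z\<close>.\<close>
    define M where "M = max 0 ((Z + A) * real (Suc m) / q)"
    obtain N where N: "\<And>n. N \<le> \<bar>n\<bar> \<Longrightarrow> 2 * (M + R + E / 2) \<le> dist p (T n p)"
      using escapes by blast
    have "Z \<le> rate_of_escape p G (mixed_measure \<mu> \<gamma>\<^sub>0 k)" if k: "nat N \<le> k" for k
    proof -
      have M: "M \<le> B k"
        using N[of "int k"] k by (simp add: B_def field_simps)
      have "(Z + A) * real (Suc m) \<le> q * M"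
        using q(1) by (simp add: M_def field_simps max_def)
      also have "\<dots> \<le> q * B k"
        using q(1) M by (intro mult_left_mono) auto
      finally have "Z \<le> (q * B k - real (Suc m) * A) / real (Suc m)"
        by (simp add: field_simps)
      also have "\<dots> \<le> rate_of_escape p G (mixed_measure \<mu> \<gamma>\<^sub>0 k)"
        using M by (intro rate) (simp add: M_def)
      finally show ?thesis .
    qed
    then show "eventually (\<lambda>k. Z \<le> rate_of_escape p G (mixed_measure \<mu> \<gamma>\<^sub>0 k)) sequentially"
      by (rule eventually_sequentiallyI)
  qed
  note rate_lim = this
  define K where "K = (shannon_entropy G \<mu> + ln 2 + ln 4) / 2"
  have entropy: "0 \<le> asymptotic_entropy G (mixed_measure \<mu> \<gamma>\<^sub>0 k)"
    "asymptotic_entropy G (mixed_measure \<mu> \<gamma>\<^sub>0 k) \<le> K" for k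
  proof -
    show "0 \<le> asymptotic_entropy G (mixed_measure \<mu> \<gamma>\<^sub>0 k)"
      by (rule isometric_walk.asymptotic_entropy_bounds(1)[OF walk])
    have "shannon_entropy G (mixed_measure \<mu> \<gamma>\<^sub>0 k) \<le> K"
      unfolding K_def
      by (rule shannon_entropy_mixed_measure_le[OF isometric_walk.support[OF walk] assms(5)])
    then show "asymptotic_entropy G (mixed_measure \<mu> \<gamma>\<^sub>0 k) \<le> K"
      using isometric_walk.asymptotic_entropy_bounds(2)[OF walk[of k]] by linarith
  qed
  show ?thesis
  proof (rule Lim_null_comparison)
    show "(\<lambda>k. K / rate_of_escape p G (mixed_measure \<mu> \<gamma>\<^sub>0 k)) \<longlonglongrightarrow> 0"
      by (intro tendsto_divide_0[OF tendsto_const] filterlim_at_top_imp_at_infinity rate_lim)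
    have "eventually (\<lambda>k. 1 \<le> rate_of_escape p G (mixed_measure \<mu> \<gamma>\<^sub>0 k)) sequentially"
      using rate_lim by (simp add: filterlim_at_top)
    then show "eventually (\<lambda>k. norm (asymptotic_entropy G (mixed_measure \<mu> \<gamma>\<^sub>0 k) /
        rate_of_escape p G (mixed_measure \<mu> \<gamma>\<^sub>0 k))
      \<le> K / rate_of_escape p G (mixed_measure \<mu> \<gamma>\<^sub>0 k)) sequentially"
      by eventually_elim (simp add: entropy divide_right_mono)
  qed
qed

end
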